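(* Let $k\geq 3$ be an integer. For a Dirichlet character $\chi$ modulo $k$ let $L(s,\chi)=\sum_{n=1}^{\infty}\chi(n)n^{-s}$ ($\operatorname{Re}s>1$). Then $$\sum_{\substack{\chi \bmod k\\ \chi(-1)=1}}|L(4,\chi)|^2=\frac{\pi^8}{27k^8}\,\phi(k)\left(\frac{J_8(k)}{700}+\frac{J_4(k)}{150}+\frac{2}{21}J_2(k)\right),$$ where the sum runs over all even Dirichlet characters modulo $k$ (including the principal character).
   Context: $\phi$ is Euler's totient function. For a positive integer $s$, the Jordan totient function is $J_s(n)=n^s\prod_{p\mid n,\ p\text{ prime}}\left(1-p^{-s}\right)$. A Dirichlet character $\chi$ is even if $\chi(-1)=1$. *)

theory Defs
  imports "HOL-Analysis.Analysis" "HOL-Number_Theory.Number_Theory"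
begin

text \<open>
  Dirichlet characters are taken as functions on the integers, so that \<open>chi (-1)\<close> is meaningful
  and distinct characters modulo \<open>k\<close> are distinct functions. The normalisation \<open>chi 1 = 1\<close>
  follows from multiplicativity and \<open>chi 1 \<noteq> 0\<close>.
\<close>
definition dirichlet_character :: "nat \<Rightarrow> (int \<Rightarrow> complex) \<Rightarrow> bool" where
  "dirichlet_character k chi \<longleftrightarrow>
     (\<forall>m n. chi (m * n) = chi m * chi n) \<and>
     (\<forall>n. chi (n + int k) = chi n) \<and>
     (\<forall>n. chi n \<noteq> 0 \<longleftrightarrow> coprime n (int k))"

definition even_dirichlet_characters :: "nat \<Rightarrow> (int \<Rightarrow> complex) set" where
  "even_dirichlet_characters k = {chi. dirichlet_character k chi \<and> chi (-1) = 1}"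

text \<open>Only meaningful for \<open>Re s > 1\<close>; the series is indexed from 0, hence the shift.\<close>
definition dirichlet_L :: "complex \<Rightarrow> (int \<Rightarrow> complex) \<Rightarrow> complex" where
  "dirichlet_L s chi = (\<Sum>n. chi (int (Suc n)) * of_nat (Suc n) powr (-s))"

definition jordan_totient :: "nat \<Rightarrow> nat \<Rightarrow> real" where
  "jordan_totient s n = real n ^ s * (\<Prod>p\<in>prime_factors n. 1 - 1 / real p ^ s)"

end

theory Submission
  imports Defs
begin

text \<open>
  For even \<open>\<chi>\<close>, grouping the series over all nonzero integers by residue classes gives
  \<open>2 k\<^sup>4 L(4, \<chi>) = \<Sum>\<^sub>a \<chi>(a) E\<^sub>4(a/k)\<close>, where \<open>E\<^sub>s(x) = \<Sum>\<^sub>m (x + m)\<^bsup>-s\<^esup>\<close> over all integers \<open>m\<close>, so by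
  orthogonality of the even characters the mean square equals
  \<open>\<phi>(k) / (4 k\<^sup>8)\<close> times the sum of \<open>E\<^sub>4(a/k)\<^sup>2\<close> over the units \<open>a\<close>.
  Herglotz' trick expresses \<open>E\<^sub>2\<close>, \<open>E\<^sub>4\<close>, \<open>E\<^sub>8\<close> as polynomials in \<open>1 / sin\<^sup>2(\<pi> x)\<close>, whence
  \<open>E\<^sub>4\<^sup>2 = E\<^sub>8 + (2/45) \<pi>\<^sup>4 E\<^sub>4 + (8/189) \<pi>\<^sup>6 E\<^sub>2\<close>. Finally a sieve over the prime factors of \<open>k\<close>
  shows that \<open>E\<^sub>s(a/k)\<close> sums over the units to \<open>E\<^sub>s(0) J\<^sub>s(k)\<close>; the case \<open>k = 2\<close> yields the
  values \<open>E\<^sub>s(0)\<close>, that is, the zeta values.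
\<close>

section \<open>Lattice sums\<close>

lemma has_sum_int_split:
  fixes f :: "int \<Rightarrow> 'a :: topological_comm_monoid_add"
  assumes "((\<lambda>n. f (int (Suc n))) has_sum S) UNIV" "((\<lambda>n. f (- int (Suc n))) has_sum T) UNIV"
  shows "(f has_sum (f 0 + (S + T))) UNIV"
proof -
  have 1: "(f has_sum S) {0<..}"
  proof -
    have "bij_betw (\<lambda>n. int (Suc n)) UNIV {0<..}"
      by (rule bij_betwI[where g = "\<lambda>i. nat i - 1"]) auto
    from has_sum_reindex_bij_betw[OF this, of f S] assms(1) show ?thesis by simp
  qed
  have 2: "(f has_sum T) {..<0}"
  proof -
    have "bij_betw (\<lambda>n. - int (Suc n)) UNIV {..<0}"
      by (rule bij_betwI[where g = "\<lambda>i. nat (-i) - 1"]) auto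
    from has_sum_reindex_bij_betw[OF this, of f T] assms(2) show ?thesis by simp
  qed
  have "(f has_sum (f 0 + (S + T))) ({0} \<union> ({0<..} \<union> {..<0}))"
    by (intro has_sum_Un_disjoint 1 2 has_sum_finiteI) auto
  also have "{0} \<union> ({0<..} \<union> {..<0}) = (UNIV :: int set)" by auto
  finally show ?thesis .
qed

lemma has_sum_residue_classes:
  fixes f :: "int \<Rightarrow> 'a :: topological_comm_monoid_add"
  assumes "n > 0" and "\<And>j. j \<in> {0..<int n} \<Longrightarrow> ((\<lambda>m. f (j + int n * m)) has_sum s j) UNIV"
  shows "(f has_sum (\<Sum>j\<in>{0..<int n}. s j)) UNIV"
proof -
  define B where "B = (\<lambda>j. range (\<lambda>m. j + int n * m))"
  have "(f has_sum (\<Sum>j\<in>{0..<int n}. s j)) (\<Union>j\<in>{0..<int n}. B j)"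
  proof (rule sum_has_sum)
    fix j assume j: "j \<in> {0..<int n}"
    have "inj (\<lambda>m. j + int n * m)" using assms(1) by (auto intro!: injI)
    then show "(f has_sum s j) (B j)"
      using assms(2)[OF j] has_sum_reindex[of "\<lambda>m. j + int n * m" UNIV f "s j"]
      by (simp add: B_def o_def)
  next
    have mod: "i mod int n = j" if "i \<in> B j" "j \<in> {0..<int n}" for i j
      using that by (auto simp: B_def)
    fix j j' assume "j \<in> {0..<int n}" "j' \<in> {0..<int n}" "j \<noteq> j'"
    then show "B j \<inter> B j' = {}" using mod by blast
  qed auto
  also have "(\<Union>j\<in>{0..<int n}. B j) = UNIV"
  proof -
    have "i \<in> B (i mod int n) \<and> i mod int n \<in> {0..<int n}" for i
      using assms(1) by (auto simp: B_def intro: range_eqI[of _ _ "i div int n"])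
    then show ?thesis by blast
  qed
  finally show ?thesis .
qed

text \<open>Since \<open>1 / 0 = 0\<close>, for integral \<open>x\<close> the singular term is simply omitted; in particular
  \<open>lattice_sum s 0\<close> is twice the zeta value at \<open>s\<close> for even \<open>s\<close>.\<close>
definition lattice_sum :: "nat \<Rightarrow> real \<Rightarrow> real" where
  "lattice_sum s x = (\<Sum>\<^sub>\<infinity>m::int. 1 / (x + of_int m) ^ s)"

lemma bij_int_add: "bij (\<lambda>m::int. c + m)"
  by (rule bij_betwI[where g = "\<lambda>m. m - c"]) auto

lemma lattice_sum_add_int: "lattice_sum s (x + of_int c) = lattice_sum s x"
  using infsum_reindex_bij_betw[OF bij_int_add[of c], of "\<lambda>m. 1 / (x + of_int m) ^ s"]
  by (simp add: lattice_sum_def add.assoc)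

lemma lattice_sum_uminus:
  assumes "even s"
  shows "lattice_sum s (- x) = lattice_sum s x"
proof -
  have "bij (uminus :: int \<Rightarrow> int)" by (rule bij_betwI[where g = uminus]) auto
  from infsum_reindex_bij_betw[OF this, of "\<lambda>m. 1 / (- x + of_int m) ^ s"]
  have "lattice_sum s (- x) = (\<Sum>\<^sub>\<infinity>m::int. 1 / (- (x + of_int m)) ^ s)"
    by (simp add: lattice_sum_def)
  then show ?thesis
    using assms by (simp only: power_minus_even lattice_sum_def)
qed

lemma summable_on_inverse_powers_int:
  assumes "s \<ge> 2"
  shows "(\<lambda>m::int. 1 / \<bar>real_of_int m\<bar> ^ s) summable_on UNIV"
proof -
  have "summable (\<lambda>n. 1 / real (Suc n) ^ s)"
    using inverse_power_summable[OF assms, where ?'a = real]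
    by (subst summable_Suc_iff) (simp add: inverse_eq_divide)
  then have "(\<lambda>n. 1 / real (Suc n) ^ s) summable_on UNIV"
    by (rule summable_nonneg_imp_summable_on) auto
  then obtain S where S: "((\<lambda>n. 1 / real (Suc n) ^ s) has_sum S) UNIV"
    by (auto simp: summable_on_def)
  have "((\<lambda>m::int. 1 / \<bar>real_of_int m\<bar> ^ s) has_sum (1 / \<bar>real_of_int 0\<bar> ^ s + (S + S))) UNIV"
  proof (rule has_sum_int_split)
    show "((\<lambda>n. 1 / \<bar>real_of_int (int (Suc n))\<bar> ^ s) has_sum S) UNIV" using S by simp
    have *: "\<bar>real_of_int (- int (Suc n))\<bar> = real (Suc n)" for n by simp
    show "((\<lambda>n. 1 / \<bar>real_of_int (- int (Suc n))\<bar> ^ s) has_sum S) UNIV" using S unfolding * .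
  qed
  then show ?thesis by (auto simp: summable_on_def)
qed

text \<open>A shift by at most \<open>1/2\<close> leaves a nonzero integer at least half its
  absolute value. The resulting majorant is summable and does not depend on
  \<open>x\<close>.\<close>

lemma lattice_term_bound:
  fixes m :: int and x :: real
  assumes "\<bar>x\<bar> \<le> 1/2" "m \<noteq> 0"
  shows "norm (1 / (x + of_int m) ^ s) \<le> 2 ^ s * (1 / \<bar>real_of_int m\<bar> ^ s)"
proof -
  have "\<bar>real_of_int m\<bar> \<ge> 1" using assms(2) by linarith
  then have *: "\<bar>x + of_int m\<bar> \<ge> \<bar>real_of_int m\<bar> / 2" "\<bar>real_of_int m\<bar> / 2 > 0"
    using assms(1) by linarith+
  then have "1 / \<bar>x + of_int m\<bar> ^ s \<le> 1 / (\<bar>real_of_int m\<bar> / 2) ^ s"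
    by (intro divide_left_mono power_mono mult_pos_pos zero_less_power) linarith+
  then show ?thesis by (simp add: power_divide power_abs)
qed

text \<open>Splitting off the term \<open>m = 0\<close> leaves a tail with a majorant uniform in
  \<open>x\<close>. So near 0 the lattice sum is its leading singularity up to a bounded error,
  which is what Herglotz' trick compares.\<close>

lemma lattice_sum_near_zero:
  assumes "s \<ge> 2" "\<bar>x\<bar> \<le> 1/2"
  shows "(\<lambda>m::int. 1 / (x + of_int m) ^ s) summable_on UNIV"
    and "\<bar>lattice_sum s x - 1 / x ^ s\<bar> \<le> 2 ^ s * (\<Sum>\<^sub>\<infinity>m\<in>-{0::int}. 1 / \<bar>real_of_int m\<bar> ^ s)"
proof -
  let ?f = "\<lambda>m::int. 1 / (x + of_int m) ^ s"
  have g: "(\<lambda>m::int. 2 ^ s * (1 / \<bar>real_of_int m\<bar> ^ s)) summable_on -{0}"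
    by (intro summable_on_cmult_right summable_on_subset_banach[OF summable_on_inverse_powers_int])
       (use assms in auto)
  then have abs: "(\<lambda>m. norm (?f m)) summable_on -{0}"
    by (rule Infinite_Sum.abs_summable_on_comparison_test') (use assms lattice_term_bound in auto)
  then have sm: "?f summable_on -{0}" by (rule abs_summable_summable)
  have ins: "insert 0 (-{0}) = (UNIV :: int set)" by auto
  show "?f summable_on UNIV"
    using sm summable_on_insert_iff[of ?f 0 "-{0}"] unfolding ins by simp
  have "lattice_sum s x = 1 / x ^ s + infsum ?f (-{0})"
    using infsum_insert[OF sm, of 0] unfolding ins by (simp add: lattice_sum_def)
  moreover have "norm (infsum ?f (-{0})) \<le> infsum (\<lambda>m. norm (?f m)) (-{0})"
    by (rule norm_infsum_bound[OF abs])
  moreover have "\<dots> \<le> infsum (\<lambda>m::int. 2 ^ s * (1 / \<bar>real_of_int m\<bar> ^ s)) (-{0})"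
    by (rule infsum_mono[OF abs g]) (use assms lattice_term_bound in auto)
  moreover have "\<dots> = 2 ^ s * (\<Sum>\<^sub>\<infinity>m\<in>-{0::int}. 1 / \<bar>real_of_int m\<bar> ^ s)"
    by (rule infsum_cmult_right')
  ultimately show "\<bar>lattice_sum s x - 1 / x ^ s\<bar> \<le> 2 ^ s * (\<Sum>\<^sub>\<infinity>m\<in>-{0::int}. 1 / \<bar>real_of_int m\<bar> ^ s)"
    by simp
qed

lemma has_sum_lattice_sum:
  assumes "s \<ge> 2"
  shows "((\<lambda>m::int. 1 / (x + of_int m) ^ s) has_sum lattice_sum s x) UNIV"
proof -
  \<comment> \<open>Subtracting the nearest integer only shifts the summation index, so the uniform
    bound near 0 gives summability everywhere.\<close>
  define y where "y = x - of_int (round x)"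
  have "\<bar>y\<bar> \<le> 1/2" using of_int_round_abs_le[of x] by (simp add: y_def abs_minus_commute)
  from lattice_sum_near_zero(1)[OF assms this]
  have "(\<lambda>m::int. 1 / (x + of_int (- round x + m)) ^ s) summable_on UNIV"
    by (simp add: y_def algebra_simps)
  then have "(\<lambda>m::int. 1 / (x + of_int m) ^ s) summable_on UNIV"
    using summable_on_reindex_bij_betw[OF bij_int_add[of "- round x"], of "\<lambda>m. 1 / (x + of_int m) ^ s"]
    by simp
  then show ?thesis unfolding lattice_sum_def by (rule has_sum_infsum)
qed

text \<open>Each integer is uniquely \<open>j + n * m\<close> with \<open>j\<close> in
  \<open>{0..<int n}\<close>, and \<open>n\<close> factors out of \<open>x + j + n * m\<close>. The
  convention \<open>1 / 0 = 0\<close> keeps this true at integral \<open>x\<close>: the case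
  \<open>x = 0\<close> starts the sieve, and \<open>n = 2\<close> is the duplication
  formula.\<close>

lemma lattice_sum_distribution:
  assumes "s \<ge> 2" "n > 0"
  shows "(\<Sum>j\<in>{0..<int n}. lattice_sum s ((x + of_int j) / real n)) = real n ^ s * lattice_sum s x"
proof -
  have "((\<lambda>m::int. 1 / (x + of_int m) ^ s) has_sum
      (\<Sum>j\<in>{0..<int n}. 1 / real n ^ s * lattice_sum s ((x + of_int j) / real n))) UNIV"
  proof (rule has_sum_residue_classes[OF assms(2)])
    fix j
    have "x + of_int (j + int n * m) = real n * ((x + of_int j) / real n + of_int m)" for m
      using assms(2) by (simp add: field_simps)
    then have "1 / (x + of_int (j + int n * m)) ^ s =
        1 / real n ^ s * (1 / ((x + of_int j) / real n + of_int m) ^ s)" for m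
      by (simp add: power_mult_distrib)
    then show "((\<lambda>m. 1 / (x + of_int (j + int n * m)) ^ s) has_sum
        1 / real n ^ s * lattice_sum s ((x + of_int j) / real n)) UNIV"
      by (simp only:) (intro has_sum_cmult_right has_sum_lattice_sum assms)
  qed
  with has_sum_lattice_sum[OF assms(1)] have
    "lattice_sum s x = (\<Sum>j\<in>{0..<int n}. 1 / real n ^ s * lattice_sum s ((x + of_int j) / real n))"
    by (rule has_sum_unique)
  then have "lattice_sum s x = 1 / real n ^ s * (\<Sum>j\<in>{0..<int n}. lattice_sum s ((x + of_int j) / real n))"
    by (simp only: sum_distrib_left)
  then show ?thesis using assms(2) by (simp add: field_simps)
qed

section \<open>Herglotz' trick\<close>

text \<open>Duplication expresses \<open>h x\<close> by two values at points of size at least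
  \<open>\<bar>x\<bar> / 2\<close>. Passing to them costs a factor \<open>2 * 2 ^ t\<close>, against
  \<open>2 ^ (t + 2)\<close> on the other side, so each application halves the constant
  \<open>M\<close>.\<close>

lemma herglotz_vanishing:
  fixes h :: "real \<Rightarrow> real"
  assumes period: "\<And>x. h (x + 1) = h x"
    and dup: "\<And>x. x \<notin> \<int> \<Longrightarrow> h (x / 2) + h ((x + 1) / 2) = 2 ^ (t + 2) * h x"
    and bound: "\<And>x. 0 < \<bar>x\<bar> \<Longrightarrow> \<bar>x\<bar> \<le> 1/2 \<Longrightarrow> \<bar>h x\<bar> \<le> M / \<bar>x\<bar> ^ t"
    and x: "0 < \<bar>x\<bar>" "\<bar>x\<bar> \<le> 1/2"
  shows "h x = 0"
proof -
  have M: "M \<ge> 0" 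
  proof -
    have "0 \<le> M / (1/2) ^ t" using order_trans[OF abs_ge_zero bound[of "1/2"]] by simp
    then show ?thesis by (simp only: zero_le_divide_iff) (smt (verit) zero_less_power zero_less_divide_1_iff)
  qed
  have it: "\<bar>h x\<bar> \<le> M / 2 ^ n / \<bar>x\<bar> ^ t" if "0 < \<bar>x\<bar>" "\<bar>x\<bar> \<le> 1/2" for n x
    using that
  proof (induction n arbitrary: x)
    case 0
    then show ?case using bound by simp
  next
    case (Suc n)
    \<comment> \<open>The representative of \<open>(x + 1) / 2\<close> modulo 1 in
      \<open>[-1/2, 1/2]\<close>; it even satisfies \<open>\<bar>y\<bar> \<ge> 1/4\<close>.\<close>
    define y where "y = (if x > 0 then (x + 1) / 2 - 1 else (x + 1) / 2)"
    have y: "\<bar>y\<bar> \<ge> \<bar>x\<bar> / 2" "\<bar>y\<bar> \<le> 1/2" using Suc.prems by (auto simp: y_def)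
    have hy: "h y = h ((x + 1) / 2)" using period[of "(x + 1) / 2 - 1"] unfolding y_def by (simp only: diff_add_cancel split: if_split) simp
    have M': "M / 2 ^ n \<ge> 0" using M by simp
    have 1: "\<bar>h (x / 2)\<bar> \<le> M / 2 ^ n / (\<bar>x\<bar> / 2) ^ t" using Suc.IH[of "x / 2"] Suc.prems by simp
    have "\<bar>h y\<bar> \<le> M / 2 ^ n / \<bar>y\<bar> ^ t" using Suc.IH[of y] y Suc.prems by simp
    also have "\<dots> \<le> M / 2 ^ n / (\<bar>x\<bar> / 2) ^ t"
      using y Suc.prems M' by (intro divide_left_mono power_mono mult_pos_pos zero_less_power) linarith+
    finally have 2: "\<bar>h ((x + 1) / 2)\<bar> \<le> M / 2 ^ n / (\<bar>x\<bar> / 2) ^ t" by (simp add: hy)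
    have "x \<notin> \<int>" using Suc.prems by (auto elim!: Ints_cases)
    from dup[OF this] have "2 ^ (t + 2) * \<bar>h x\<bar> = \<bar>h (x / 2) + h ((x + 1) / 2)\<bar>"
      by (simp add: abs_mult)
    also have "\<dots> \<le> 2 * (M / 2 ^ n / (\<bar>x\<bar> / 2) ^ t)" using 1 2 by linarith
    also have "\<dots> = 2 ^ (t + 2) * (M / 2 ^ Suc n / \<bar>x\<bar> ^ t)" by (simp add: power_divide)
    finally show ?case by (rule mult_left_le_imp_le) simp
  qed
  have "(\<lambda>n. M / 2 ^ n / \<bar>x\<bar> ^ t) \<longlonglongrightarrow> 0"
  proof -
    have "(\<lambda>n. M / \<bar>x\<bar> ^ t * (1/2) ^ n) \<longlonglongrightarrow> M / \<bar>x\<bar> ^ t * 0"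
      by (intro tendsto_intros LIMSEQ_power_zero) auto
    then show ?thesis by (simp add: power_divide mult.commute)
  qed
  then have "\<bar>h x\<bar> \<le> 0" by (rule LIMSEQ_le_const) (use it x in auto)
  then show ?thesis by simp
qed

text \<open>Herglotz' trick: the difference satisfies the duplication formula with factor \<open>2 ^ s\<close>, which
  beats a singularity of order \<open>s - 2\<close>, so only the leading singularity has to match.\<close>
lemma lattice_sum_eqI:
  fixes Q :: "real \<Rightarrow> real"
  assumes s: "s = t + 2"
    and period: "\<And>x. Q (x + 1) = Q x"
    and dup: "\<And>x. x \<notin> \<int> \<Longrightarrow> Q (x / 2) + Q ((x + 1) / 2) = 2 ^ s * Q x"
    and bound: "\<And>x. 0 < \<bar>x\<bar> \<Longrightarrow> \<bar>x\<bar> \<le> 1/2 \<Longrightarrow> \<bar>Q x - 1 / x ^ s\<bar> \<le> M / \<bar>x\<bar> ^ t"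
    and x: "x \<notin> \<int>"
  shows "lattice_sum s x = Q x"
proof -
  define h where "h = (\<lambda>x. lattice_sum s x - Q x)"
  define C where "C = 2 ^ s * (\<Sum>\<^sub>\<infinity>m\<in>-{0::int}. 1 / \<bar>real_of_int m\<bar> ^ s)"
  have per: "h (x + 1) = h x" for x
    using lattice_sum_add_int[of s x 1] period by (simp add: h_def)
  have per': "h (x + of_int i) = h x" for x i
  proof (induction i rule: int_induct[where k = 0])
    case base
    then show ?case by simp
  next
    case (step1 i)
    then show ?case using per[of "x + of_int i"] by (simp add: add.assoc)
  next
    case (step2 i)
    then show ?case using per[of "x + of_int (i - 1)"] by (simp add: add.assoc)
  qed
  have C: "C \<ge> 0" unfolding C_def by (intro mult_nonneg_nonneg infsum_nonneg) auto
  \<comment> \<open>Reduction to the nearest integer; \<open>y\<close> is nonzero because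
    \<open>x\<close> is not integral.\<close>
  define y where "y = x - of_int (round x)"
  have y: "0 < \<bar>y\<bar>" "\<bar>y\<bar> \<le> 1/2"
    using of_int_round_abs_le[of x] x by (auto simp: y_def abs_minus_commute) (metis Ints_of_int)
  have "h y = 0"
  proof (rule herglotz_vanishing[where h = h, OF per _ _ y])
    fix x :: real assume "x \<notin> \<int>"
    have "{0..<2} = {0, 1::int}" by auto
    then have "lattice_sum s (x / 2) + lattice_sum s ((x + 1) / 2) = 2 ^ s * lattice_sum s x"
      using lattice_sum_distribution[of s 2 x] s by simp
    then show "h (x / 2) + h ((x + 1) / 2) = 2 ^ (t + 2) * h x"
      using dup[OF \<open>x \<notin> \<int>\<close>] s by (simp add: h_def algebra_simps)
  next
    fix x :: real assume x: "0 < \<bar>x\<bar>" "\<bar>x\<bar> \<le> 1/2"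
    have "\<bar>lattice_sum s x - 1 / x ^ s\<bar> \<le> C" unfolding C_def by (rule lattice_sum_near_zero) (use x s in auto)
    then have "\<bar>h x\<bar> \<le> C + M / \<bar>x\<bar> ^ t" using bound[OF x] by (simp add: h_def)
    \<comment> \<open>The bounded error is absorbed into the singularity of order \<open>t\<close>,
      as \<open>\<bar>x\<bar> \<le> 1\<close>.\<close>
    also have "C \<le> C / \<bar>x\<bar> ^ t" using C x by (simp add: field_simps mult_left_le power_le_one)
    finally show "\<bar>h x\<bar> \<le> (C + M) / \<bar>x\<bar> ^ t" by (simp add: add_divide_distrib)
  qed
  moreover have "h x = h y" using per'[of y "round x"] by (simp add: y_def)
  ultimately show ?thesis by (simp add: h_def)
qed

section \<open>Evaluation by cosecants\<close>

lemma sin_bounds_first_quadrant: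
  assumes "0 < y" "y \<le> pi / 2"
  shows "y - y ^ 3 / 6 \<le> sin y" "y / 2 \<le> sin y" "sin y \<le> y"
proof -
  have "\<bar>sin y - (\<Sum>m<3. sin_coeff m * y ^ m)\<bar> \<le> inverse (fact 3) * \<bar>y\<bar> ^ 3"
    by (rule Maclaurin_sin_bound)
  then have "\<bar>sin y - y\<bar> \<le> y ^ 3 / 6"
    using assms by (simp add: sin_coeff_def eval_nat_numeral)
  then show 1: "y - y ^ 3 / 6 \<le> sin y" by linarith
  \<comment> \<open>From \<open>y \<le> 1.6\<close> follows \<open>y * y \<le> 2.56 < 3\<close>, so
    the cubic term \<open>y ^ 3 / 6\<close> takes away at most half of \<open>y\<close>.\<close>
  have "y \<le> 1.6" using assms pi_less_4 pi_approx by simp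
  then have "y * y \<le> 1.6 * 1.6" using assms by (intro mult_mono) auto
  then have "y * (y * y) \<le> y * 3" using assms by (intro mult_left_mono) auto
  then show "y / 2 \<le> sin y" using 1 by (simp add: power3_eq_cube)
  show "sin y \<le> y" using assms by (intro sin_x_le_x) auto
qed

definition csc2 :: "real \<Rightarrow> real" where
  "csc2 x = 1 / (sin (pi * x))\<^sup>2"

lemma csc2_bounds:
  assumes "0 < \<bar>x\<bar>" "\<bar>x\<bar> \<le> 1/2"
  shows "pi\<^sup>2 * csc2 x \<le> 4 * (1 / x\<^sup>2)" "\<bar>pi\<^sup>2 * csc2 x - 1 / x\<^sup>2\<bar> \<le> 14" "pi\<^sup>2 * csc2 x \<ge> 0"
proof -
  define y where "y = pi * \<bar>x\<bar>"
  define S where "S = sin y"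
  have y: "0 < y" "y \<le> pi / 2" using assms by (auto simp: y_def)
  note sb = sin_bounds_first_quadrant[OF y, folded S_def]
  have S: "S > 0" using sb y by linarith
  \<comment> \<open>\<open>csc2\<close> is even, so \<open>x\<close> may be replaced by its absolute
    value and the sine bounds apply.\<close>
  have c: "csc2 x = 1 / S\<^sup>2" by (cases "x \<ge> 0") (auto simp: S_def y_def csc2_def)
  have x: "1 / x\<^sup>2 = pi\<^sup>2 * (1 / y\<^sup>2)" by (simp add: y_def power_mult_distrib)
  have "1 / S\<^sup>2 \<le> 1 / (y / 2)\<^sup>2" using sb y S by (intro divide_left_mono power_mono mult_pos_pos) auto
  then have le: "1 / S\<^sup>2 \<le> 4 * (1 / y\<^sup>2)" by (simp add: power_divide)
  then have "pi\<^sup>2 * (1 / S\<^sup>2) \<le> pi\<^sup>2 * (4 * (1 / y\<^sup>2))" by (intro mult_left_mono) auto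
  then show "pi\<^sup>2 * csc2 x \<le> 4 * (1 / x\<^sup>2)" unfolding c x by (simp only: mult_ac)
  have d: "1 / S\<^sup>2 - 1 / y\<^sup>2 = ((y - S) * (y + S)) * (1 / S\<^sup>2) * (1 / y\<^sup>2)"
    using y S by (simp add: field_simps power2_eq_square)
  \<comment> \<open>Here \<open>y - S \<le> y ^ 3 / 6\<close>, \<open>y + S \<le> 2 * y\<close> and
    \<open>1 / S\<^sup>2 \<le> 4 * (1 / y\<^sup>2)\<close>; all powers of \<open>y\<close> cancel.
    With \<open>pi\<^sup>2 \<le> 10.5\<close> the final constant is
    \<open>10.5 * 4/3 = 14\<close>.\<close>
  also have "\<dots> \<le> ((y ^ 3 / 6) * (2 * y)) * (4 * (1 / y\<^sup>2)) * (1 / y\<^sup>2)"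
    using sb y S le by (intro mult_mono) auto
  also have "\<dots> = 4 / 3" using y by (simp add: field_simps eval_nat_numeral)
  finally have u: "1 / S\<^sup>2 - 1 / y\<^sup>2 \<le> 4 / 3" .
  have l: "0 \<le> 1 / S\<^sup>2 - 1 / y\<^sup>2" unfolding d using sb y S by auto
  have "pi\<^sup>2 * (1 / S\<^sup>2) - pi\<^sup>2 * (1 / y\<^sup>2) = pi\<^sup>2 * (1 / S\<^sup>2 - 1 / y\<^sup>2)" by (simp add: algebra_simps)
  moreover have "\<dots> \<le> 10.5 * (4 / 3)"
  proof (intro mult_mono u l)
    have "pi * pi \<le> 3.2 * 3.2" using pi_approx by (intro mult_mono) auto
    then show "pi\<^sup>2 \<le> 10.5" by (simp add: power2_eq_square)
  qed auto
  moreover have "0 \<le> pi\<^sup>2 * (1 / S\<^sup>2 - 1 / y\<^sup>2)" using l by simp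
  ultimately show "\<bar>pi\<^sup>2 * csc2 x - 1 / x\<^sup>2\<bar> \<le> 14" unfolding c x by simp
qed (simp add: csc2_def)

lemma csc2_period: "csc2 (x + 1) = csc2 x"
  by (simp add: csc2_def algebra_simps)

lemma sin_pi_zero_iff: "sin (pi * x) = 0 \<longleftrightarrow> x \<in> \<int>"
proof
  assume "sin (pi * x) = 0"
  then obtain i :: int where "pi * x = of_int i * pi" by (auto simp: sin_zero_iff_int2)
  then have "x = of_int i" by simp
  then show "x \<in> \<int>" by simp
next
  assume "x \<in> \<int>"
  then show "sin (pi * x) = 0" by (auto elim!: Ints_cases simp: sin_zero_iff_int2)
qed

text \<open>With \<open>u\<close> the squared sine of half the angle, the shift by
  \<open>pi / 2\<close> produces the squared cosine \<open>1 - u\<close>, and the double angle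
  formula gives \<open>4 * u * (1 - u)\<close>. Duplication formulas for polynomials in
  \<open>csc2\<close> thereby become rational identities in \<open>u\<close>.\<close>

lemma csc2_duplication:
  assumes "x \<notin> \<int>"
  obtains u where "csc2 (x / 2) = 1 / u" "csc2 ((x + 1) / 2) = 1 / (1 - u)"
    "csc2 x = 1 / (4 * u * (1 - u))" "u \<noteq> 0" "1 - u \<noteq> 0"
proof
  define u where "u = (sin (pi * (x / 2)))\<^sup>2"
  have s: "(sin (pi * ((x + 1) / 2)))\<^sup>2 = 1 - u"
  proof -
    have "sin (pi * ((x + 1) / 2)) = sin (pi * (x / 2) + pi / 2)" by (simp add: field_simps)
    also have "\<dots> = cos (pi * (x / 2))" by (simp add: sin_add)
    finally show ?thesis by (simp add: u_def cos_squared_eq)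
  qed
  have "sin (pi * x) = sin (2 * (pi * (x / 2)))" by simp
  then have d: "(sin (pi * x))\<^sup>2 = 4 * u * (1 - u)"
    by (simp only: sin_double power_mult_distrib cos_squared_eq u_def) simp
  show "csc2 (x / 2) = 1 / u" "csc2 ((x + 1) / 2) = 1 / (1 - u)" "csc2 x = 1 / (4 * u * (1 - u))"
    unfolding csc2_def s d by (simp_all add: u_def)
  have "4 * u * (1 - u) \<noteq> 0" using assms unfolding d[symmetric] by (simp add: sin_pi_zero_iff)
  then show "u \<noteq> 0" "1 - u \<noteq> 0" by auto
qed

section \<open>Closed forms for exponents 2, 4 and 8\<close>

lemma lattice_sum_2:
  assumes "x \<notin> \<int>"
  shows "lattice_sum 2 x = pi ^ 2 * csc2 x"
proof (rule lattice_sum_eqI[where t = 0 and M = 14])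
  fix x :: real assume "x \<notin> \<int>"
  then obtain u where u: "csc2 (x / 2) = 1 / u" "csc2 ((x + 1) / 2) = 1 / (1 - u)"
    "csc2 x = 1 / (4 * u * (1 - u))" "u \<noteq> 0" "1 - u \<noteq> 0" by (rule csc2_duplication)
  show "pi ^ 2 * csc2 (x / 2) + pi ^ 2 * csc2 ((x + 1) / 2) = 2 ^ 2 * (pi ^ 2 * csc2 x)"
    unfolding u(1-3) using u(4,5) by (simp add: divide_simps) (simp add: algebra_simps)
qed (use assms csc2_bounds in \<open>simp_all add: csc2_period\<close>)

text \<open>The coefficient is forced by duplication. If \<open>p\<close>, \<open>q\<close> are the
  values of \<open>csc2\<close> at the two half points and \<open>e = p + q = p * q\<close>, then
  \<open>csc2 x = e / 4\<close> and \<open>p\<^sup>2 + q\<^sup>2 = e\<^sup>2 - 2 * e\<close>; a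
  linear coefficient \<open>c\<close> must satisfy \<open>c - 2 = 4 * c\<close>.\<close>

lemma lattice_sum_4:
  assumes "x \<notin> \<int>"
  shows "lattice_sum 4 x = pi ^ 4 * (csc2 x ^ 2 - 2/3 * csc2 x)"
proof (rule lattice_sum_eqI[where t = 2 and M = "14 * 5 + pi\<^sup>2 * (2/3) * 4"])
  fix x :: real assume "x \<notin> \<int>"
  then obtain u where u: "csc2 (x / 2) = 1 / u" "csc2 ((x + 1) / 2) = 1 / (1 - u)"
    "csc2 x = 1 / (4 * u * (1 - u))" "u \<noteq> 0" "1 - u \<noteq> 0" by (rule csc2_duplication)
  show "pi ^ 4 * ((csc2 (x / 2))\<^sup>2 - 2 / 3 * csc2 (x / 2)) +
         pi ^ 4 * ((csc2 ((x + 1) / 2))\<^sup>2 - 2 / 3 * csc2 ((x + 1) / 2)) =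
         2 ^ 4 * (pi ^ 4 * ((csc2 x)\<^sup>2 - 2 / 3 * csc2 x))"
    unfolding u(1-3) using u(4,5)
    by (simp add: divide_simps) (simp add: algebra_simps eval_nat_numeral)
next
  fix x :: real assume x: "0 < \<bar>x\<bar>" "\<bar>x\<bar> \<le> 1/2"
  define v where "v = 1 / x\<^sup>2"
  define w where "w = pi\<^sup>2 * csc2 x"
  note b = csc2_bounds[OF x, folded v_def w_def]
  have v: "v \<ge> 0" by (simp add: v_def)
  have "\<bar>w\<^sup>2 - v\<^sup>2\<bar> = \<bar>w - v\<bar> * (w + v)"
    using v b(3) abs_mult[of "w - v" "w + v"] by (simp add: power2_eq_square algebra_simps)
  \<comment> \<open>Both \<open>\<bar>w - v\<bar> \<le> 14\<close> and \<open>w \<le> 4 * v\<close>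
    come from \<open>csc2_bounds\<close>; hence the \<open>14 * 5\<close> in
    \<open>M\<close>.\<close>
  also have "\<dots> \<le> 14 * (4 * v + v)" using b v by (intro mult_mono add_mono) auto
  finally have 1: "\<bar>w\<^sup>2 - v\<^sup>2\<bar> \<le> 14 * 5 * v" by simp
  have 2: "pi\<^sup>2 * (2/3) * w \<le> pi\<^sup>2 * (2/3) * (4 * v)" "0 \<le> pi\<^sup>2 * (2/3) * w"
    using b by (auto intro!: mult_left_mono)
  have "pi ^ 4 * ((csc2 x)\<^sup>2 - 2 / 3 * csc2 x) - 1 / x ^ 4 = (w\<^sup>2 - v\<^sup>2) - pi\<^sup>2 * (2/3) * w"
    by (simp add: w_def v_def algebra_simps eval_nat_numeral)
  then have "\<bar>pi ^ 4 * ((csc2 x)\<^sup>2 - 2 / 3 * csc2 x) - 1 / x ^ 4\<bar> \<le> (14 * 5 + pi\<^sup>2 * (2/3) * 4) * v"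
    unfolding distrib_right using 1 2 by linarith
  then show "\<bar>pi ^ 4 * ((csc2 x)\<^sup>2 - 2 / 3 * csc2 x) - 1 / x ^ 4\<bar> \<le> (14 * 5 + pi\<^sup>2 * (2/3) * 4) / \<bar>x\<bar>\<^sup>2"
    by (simp add: v_def)
qed (use assms in \<open>simp_all add: csc2_period\<close>)

text \<open>Again duplication forces the coefficients, from the top degree down:
  \<open>-4 + c3 = 4 * c3\<close>, then \<open>2 - 3 * c3 + c2 = 16 * c2\<close>, then
  \<open>-2 * c2 + c1 = 64 * c1\<close>.\<close>

lemma lattice_sum_8:
  assumes "x \<notin> \<int>"
  shows "lattice_sum 8 x = pi ^ 8 * (csc2 x ^ 4 - 4/3 * csc2 x ^ 3 + 2/5 * csc2 x ^ 2 - 4/315 * csc2 x)"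
proof (rule lattice_sum_eqI[where t = 6 and
      M = "14 * 85 + (pi\<^sup>2 * (4/3) * 64 + pi ^ 4 * (2/5) * 16 + pi ^ 6 * (4/315) * 4)"])
  fix x :: real assume "x \<notin> \<int>"
  then obtain u where u: "csc2 (x / 2) = 1 / u" "csc2 ((x + 1) / 2) = 1 / (1 - u)"
    "csc2 x = 1 / (4 * u * (1 - u))" "u \<noteq> 0" "1 - u \<noteq> 0" by (rule csc2_duplication)
  define p where "p = 1 / u"
  define q where "q = 1 / (1 - u)"
  \<comment> \<open>This is \<open>u + (1 - u) = 1\<close> divided by \<open>u * (1 - u)\<close>.
    Both elementary symmetric functions of \<open>p\<close> and \<open>q\<close> equal
    \<open>e\<close>, so all power sums are polynomials in \<open>e\<close> alone.\<close>
  have pq: "p + q = p * q" using u(4,5) by (simp add: p_def q_def field_simps)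
  have c: "csc2 x = p * q / 4" unfolding u p_def q_def by simp
  define e where "e = p * q"
  have sm: "p + q = e" and pr: "p * q = e" using pq by (simp_all add: e_def)
  have "p ^ 2 + q ^ 2 = (p + q) ^ 2 - 2 * (p * q)" by (simp add: power2_eq_square algebra_simps)
  then have 2: "p ^ 2 + q ^ 2 = e ^ 2 - 2 * e" by (simp only: sm pr)
  have "p ^ 3 + q ^ 3 = (p + q) ^ 3 - 3 * (p * q) * (p + q)" by (simp add: eval_nat_numeral algebra_simps)
  then have 3: "p ^ 3 + q ^ 3 = e ^ 3 - 3 * e ^ 2" by (simp only: sm pr) (simp add: power2_eq_square)
  have "p ^ 4 + q ^ 4 = (p + q) ^ 4 - 4 * (p * q) * (p + q) ^ 2 + 2 * (p * q) ^ 2" by (simp add: eval_nat_numeral algebra_simps)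
  then have 4: "p ^ 4 + q ^ 4 = e ^ 4 - 4 * e ^ 3 + 2 * e ^ 2"
    by (simp only: sm pr) (simp add: eval_nat_numeral)
  have "(p ^ 4 - 4/3 * p ^ 3 + 2/5 * p ^ 2 - 4/315 * p) + (q ^ 4 - 4/3 * q ^ 3 + 2/5 * q ^ 2 - 4/315 * q)
      = (p ^ 4 + q ^ 4) - 4/3 * (p ^ 3 + q ^ 3) + 2/5 * (p ^ 2 + q ^ 2) - 4/315 * (p + q)"
    by (simp add: algebra_simps)
  also have "\<dots> = 2 ^ 8 * ((e/4) ^ 4 - 4/3 * (e/4) ^ 3 + 2/5 * (e/4) ^ 2 - 4/315 * (e/4))"
    unfolding 2 3 4 sm by (simp add: power_divide field_simps)
  finally have "pi ^ 8 * ((p ^ 4 - 4/3 * p ^ 3 + 2/5 * p ^ 2 - 4/315 * p) + (q ^ 4 - 4/3 * q ^ 3 + 2/5 * q ^ 2 - 4/315 * q))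
      = pi ^ 8 * (2 ^ 8 * ((e/4) ^ 4 - 4/3 * (e/4) ^ 3 + 2/5 * (e/4) ^ 2 - 4/315 * (e/4)))"
    by (rule arg_cong)
  then show "pi ^ 8 * (csc2 (x / 2) ^ 4 - 4/3 * csc2 (x / 2) ^ 3 + 2/5 * csc2 (x / 2) ^ 2 - 4/315 * csc2 (x / 2)) +
        pi ^ 8 * (csc2 ((x + 1) / 2) ^ 4 - 4/3 * csc2 ((x + 1) / 2) ^ 3 + 2/5 * csc2 ((x + 1) / 2) ^ 2 - 4/315 * csc2 ((x + 1) / 2)) =
        2 ^ 8 * (pi ^ 8 * (csc2 x ^ 4 - 4/3 * csc2 x ^ 3 + 2/5 * csc2 x ^ 2 - 4/315 * csc2 x))"
    unfolding c u(1,2) p_def[symmetric] q_def[symmetric] e_def[symmetric] by (simp only: ring_distribs mult.left_commute)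
next
  fix x :: real assume x: "0 < \<bar>x\<bar>" "\<bar>x\<bar> \<le> 1/2"
  define v where "v = 1 / x\<^sup>2"
  define w where "w = pi\<^sup>2 * csc2 x"
  note b = csc2_bounds[OF x, folded v_def w_def]
  have "x\<^sup>2 \<le> 1" using x by (simp add: abs_square_le_1)
  \<comment> \<open>Since \<open>v \<ge> 1\<close>, every lower power of \<open>v\<close> is
    dominated by \<open>v ^ 3\<close>, the singularity of order 6 that is permitted.\<close>
  then have v: "v \<ge> 1" using x by (simp add: v_def)
  have 1: "w ^ j \<le> 4 ^ j * v ^ 3" if "j \<le> 3" for j
  proof -
    have "w ^ j \<le> (4 * v) ^ j" using b by (intro power_mono) auto
    also have "\<dots> \<le> 4 ^ j * v ^ 3" using v that by (simp add: power_mult_distrib power_increasing)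
    finally show ?thesis .
  qed
  have "\<bar>w ^ 4 - v ^ 4\<bar> = \<bar>w - v\<bar> * (w ^ 3 + w ^ 2 * v + w * v ^ 2 + v ^ 3)"
  proof -
    have "w ^ 4 - v ^ 4 = (w - v) * (w ^ 3 + w ^ 2 * v + w * v ^ 2 + v ^ 3)"
      by (simp add: eval_nat_numeral algebra_simps)
    moreover have "w ^ 3 + w ^ 2 * v + w * v ^ 2 + v ^ 3 \<ge> 0" using b v by auto
    ultimately show ?thesis by (simp add: abs_mult)
  qed
  \<comment> \<open>By \<open>w \<le> 4 * v\<close> the second factor is at most
    \<open>64 + 16 + 4 + 1 = 85\<close> times \<open>v ^ 3\<close>.\<close>
  also have "\<dots> \<le> 14 * ((4 * v) ^ 3 + (4 * v) ^ 2 * v + (4 * v) * v ^ 2 + v ^ 3)"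
    using b v by (intro mult_mono add_mono power_mono) auto
  also have "\<dots> = 14 * 85 * v ^ 3" by (simp add: eval_nat_numeral)
  finally have 2: "\<bar>w ^ 4 - v ^ 4\<bar> \<le> 14 * 85 * v ^ 3" .
  let ?R = "pi\<^sup>2 * (4/3) * w ^ 3 - pi ^ 4 * (2/5) * w ^ 2 + pi ^ 6 * (4/315) * w ^ 1"
  let ?P = "pi\<^sup>2 * (4/3) * w ^ 3 + pi ^ 4 * (2/5) * w ^ 2 + pi ^ 6 * (4/315) * w ^ 1"
  have "\<bar>?R\<bar> \<le> ?P"
  proof -
    have "pi\<^sup>2 * (4/3) * w ^ 3 \<ge> 0" "pi ^ 4 * (2/5) * w ^ 2 \<ge> 0" "pi ^ 6 * (4/315) * w ^ 1 \<ge> 0"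
      using b by auto
    then show ?thesis by linarith
  qed
  also have "?P \<le> pi\<^sup>2 * (4/3) * (4 ^ 3 * v ^ 3) + pi ^ 4 * (2/5) * (4 ^ 2 * v ^ 3) + pi ^ 6 * (4/315) * (4 ^ 1 * v ^ 3)"
    by (intro add_mono mult_left_mono 1) auto
  finally have 3: "\<bar>?R\<bar> \<le> (pi\<^sup>2 * (4/3) * 64 + pi ^ 4 * (2/5) * 16 + pi ^ 6 * (4/315) * 4) * v ^ 3"
    by (simp add: algebra_simps)
  have eq: "pi ^ 8 * (csc2 x ^ 4 - 4/3 * csc2 x ^ 3 + 2/5 * csc2 x ^ 2 - 4/315 * csc2 x) - 1 / x ^ 8
      = (w ^ 4 - v ^ 4) - ?R"
    by (simp add: w_def v_def algebra_simps eval_nat_numeral)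
  have "v ^ 3 = 1 / \<bar>x\<bar> ^ 6" by (simp add: v_def power_divide flip: power_mult)
  then have "(14 * 85 + (pi\<^sup>2 * (4/3) * 64 + pi ^ 4 * (2/5) * 16 + pi ^ 6 * (4/315) * 4)) / \<bar>x\<bar> ^ 6
    = 14 * 85 * v ^ 3 + (pi\<^sup>2 * (4/3) * 64 + pi ^ 4 * (2/5) * 16 + pi ^ 6 * (4/315) * 4) * v ^ 3"
    by (simp add: add_divide_distrib)
  then show "\<bar>pi ^ 8 * (csc2 x ^ 4 - 4/3 * csc2 x ^ 3 + 2/5 * csc2 x ^ 2 - 4/315 * csc2 x) - 1 / x ^ 8\<bar>
      \<le> (14 * 85 + (pi\<^sup>2 * (4/3) * 64 + pi ^ 4 * (2/5) * 16 + pi ^ 6 * (4/315) * 4)) / \<bar>x\<bar> ^ 6"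
    unfolding eq using 2 3 by linarith
qed (use assms in \<open>simp_all add: csc2_period\<close>)

text \<open>As polynomials in \<open>csc2\<close>, the square and \<open>lattice_sum 8\<close> agree
  in degrees 4 and 3. The quadratic gap \<open>4/9 - 2/5 = 2/45\<close> is filled by
  \<open>lattice_sum 4\<close>, and the remaining linear gap \<open>4/315 + 4/135 = 8/189\<close> by
  \<open>lattice_sum 2\<close>.\<close>

lemma lattice_sum_4_squared:
  assumes "x \<notin> \<int>"
  shows "(lattice_sum 4 x)\<^sup>2 =
    lattice_sum 8 x + 2/45 * pi ^ 4 * lattice_sum 4 x + 8/189 * pi ^ 6 * lattice_sum 2 x"
  unfolding lattice_sum_2[OF assms] lattice_sum_4[OF assms] lattice_sum_8[OF assms]
  by (simp add: eval_nat_numeral algebra_simps add_divide_distrib diff_divide_distrib)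

section \<open>Summation over units\<close>

text \<open>Primes are sieved out one at a time. For \<open>n = q * m\<close> the multiples of
  \<open>q\<close> are \<open>q * b\<close> with \<open>b\<close> below \<open>m\<close>, and
  \<open>q * b / n = b / m\<close>; they contribute the same expression at \<open>m\<close>, which
  is \<open>1 / q ^ s\<close> times that at \<open>n\<close>. The induction hypothesis is used at
  both \<open>n\<close> and \<open>m\<close>, hence the arbitrary \<open>n\<close>.\<close>

lemma lattice_sum_sieve:
  assumes s: "s \<ge> 2" and P: "finite P" "\<And>p. p \<in> P \<Longrightarrow> prime p"
    and n: "n > 0" "\<And>p. p \<in> P \<Longrightarrow> p dvd n"
  shows "(\<Sum>a | a \<in> {0..<int n} \<and> (\<forall>p\<in>P. \<not> int p dvd a). lattice_sum s (of_int a / real n)) =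
    lattice_sum s 0 * (real n ^ s * (\<Prod>p\<in>P. 1 - 1 / real p ^ s))"
  using P n
proof (induction P arbitrary: n rule: finite_induct)
  case empty
  have "{a. a \<in> {0..<int n} \<and> (\<forall>p\<in>{}. \<not> int p dvd a)} = {0..<int n}" by auto
  then show ?case using lattice_sum_distribution[OF s, of n 0] empty by simp
next
  case (insert q P n)
  let ?A = "{a. a \<in> {0..<int n} \<and> (\<forall>p\<in>P. \<not> int p dvd a)}"
  let ?f = "\<lambda>a. lattice_sum s (of_int a / real n)"
  have q: "prime q" "q > 0" using insert.prems by (auto simp: prime_gt_0_nat)
  obtain m where m: "n = q * m" using insert.prems by blast
  have m0: "m > 0" using insert.prems m by (auto intro: Nat.gr0I)
  let ?B = "{a. a \<in> {0..<int m} \<and> (\<forall>p\<in>P. \<not> int p dvd a)}"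
  \<comment> \<open>Distinct primes are coprime, so removing the factor \<open>q\<close> changes no
    divisibility condition for the primes in \<open>P\<close>.\<close>
  have cop: "int p dvd int q * b \<longleftrightarrow> int p dvd b" if "p \<in> P" for p b
  proof -
    have "coprime (int p) (int q)"
      using that insert.hyps insert.prems q by (auto intro!: primes_coprime)
    then show ?thesis by (simp add: coprime_dvd_mult_right_iff)
  qed
  have dvdm: "p dvd m" if "p \<in> P" for p
  proof -
    have "coprime p q" using that insert.hyps insert.prems q by (auto intro!: primes_coprime)
    moreover have "p dvd q * m" using that insert.prems m by auto
    ultimately show ?thesis by (simp add: coprime_dvd_mult_right_iff)
  qed
  have "{a \<in> ?A. int q dvd a} = (\<lambda>b. int q * b) ` ?B"
  proof (intro equalityI subsetI)
    fix a assume a: "a \<in> {a \<in> ?A. int q dvd a}"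
    then obtain b where b: "a = int q * b" by auto
    then have "0 \<le> b" "b < int m" using a q m by (auto simp: zero_le_mult_iff)
    then show "a \<in> (\<lambda>b. int q * b) ` ?B" using a b cop by auto
  qed (use q m cop in auto)
  then have "sum ?f {a \<in> ?A. int q dvd a} = (\<Sum>b\<in>?B. ?f (int q * b))"
    using q by (simp add: sum.reindex inj_on_def)
  also have "\<dots> = (\<Sum>b\<in>?B. lattice_sum s (of_int b / real m))"
    using q m by (intro sum.cong) auto
  also have "\<dots> = lattice_sum s 0 * (real m ^ s * (\<Prod>p\<in>P. 1 - 1 / real p ^ s))"
    using insert.prems m0 dvdm by (intro insert.IH) auto
  finally have 1: "sum ?f {a \<in> ?A. int q dvd a} = \<dots>" .
  have 2: "sum ?f ?A = lattice_sum s 0 * (real n ^ s * (\<Prod>p\<in>P. 1 - 1 / real p ^ s))"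
    using insert.prems by (intro insert.IH) auto
  have fin: "finite ?A" by (rule finite_subset[of _ "{0..<int n}"]) auto
  have "{a. a \<in> {0..<int n} \<and> (\<forall>p\<in>insert q P. \<not> int p dvd a)} = ?A - {a \<in> ?A. int q dvd a}" by auto
  then have "sum ?f {a. a \<in> {0..<int n} \<and> (\<forall>p\<in>insert q P. \<not> int p dvd a)} = sum ?f ?A - sum ?f {a \<in> ?A. int q dvd a}"
    using fin by (simp only:) (intro sum_diff, auto)
  also have "\<dots> = lattice_sum s 0 * (real n ^ s * (\<Prod>p\<in>insert q P. 1 - 1 / real p ^ s))"
    unfolding 1 2 using insert.hyps q m by (simp add: field_simps power_mult_distrib)
  finally show ?case .
qed

definition residue_units :: "nat \<Rightarrow> int set" where
  "residue_units k = {a. a \<in> {0..<int k} \<and> coprime a (int k)}"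

text \<open>This turns the unit condition into the condition of the sieve; a common divisor that is
  not a unit has a prime factor.\<close>

lemma coprime_iff_no_prime_factor_dvd:
  assumes "k > 0"
  shows "coprime a (int k) \<longleftrightarrow> (\<forall>p\<in>prime_factors k. \<not> int p dvd a)"
proof
  assume c: "coprime a (int k)"
  show "\<forall>p\<in>prime_factors k. \<not> int p dvd a"
  proof (intro ballI notI)
    fix p assume p: "p \<in> prime_factors k" "int p dvd a"
    then have "int p dvd int k" "prime p" by auto
    with c p(2) have "is_unit (int p)" by (meson coprime_common_divisor)
    with \<open>prime p\<close> show False by auto
  qed
next
  assume h: "\<forall>p\<in>prime_factors k. \<not> int p dvd a"
  show "coprime a (int k)"
  proof (rule ccontr)
    assume "\<not> coprime a (int k)"
    then obtain c where c: "c dvd a" "c dvd int k" "\<not> is_unit c" by (rule not_coprimeE)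
    with assms have "c \<noteq> 0" by auto
    then obtain p where p: "prime p" "p dvd c" using c prime_divisor_exists by blast
    from p(1) have "p \<ge> 0 \<and> prime (nat p)" by (rule prime_int_nat_transfer[THEN iffD1])
    moreover from this obtain r where r: "p = int r" using nonneg_int_cases by blast
    ultimately have "prime r" by simp
    moreover have "int r dvd a" "int r dvd int k" using p(2) c r dvd_trans by blast+
    ultimately have "r \<in> prime_factors k" "int r dvd a"
      using assms by (simp_all add: prime_factors_dvd)
    with h show False by auto
  qed
qed

lemma sum_lattice_sum_units:
  assumes "s \<ge> 2" "k > 0"
  shows "(\<Sum>a\<in>residue_units k. lattice_sum s (of_int a / real k)) = lattice_sum s 0 * jordan_totient s k"
  unfolding residue_units_def jordan_totient_def coprime_iff_no_prime_factor_dvd[OF assms(2)]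
  by (rule lattice_sum_sieve) (use assms in auto)

section \<open>Values at 0 and the sum of squares over units\<close>

text \<open>Modulo 2 the only unit is 1 and the Jordan totient is \<open>2 ^ s - 1\<close>, so the
  sum over units consists of the single value at \<open>1/2\<close>.\<close>

lemma lattice_sum_0:
  assumes "s \<ge> 2"
  shows "lattice_sum s 0 = lattice_sum s (1/2) / (2 ^ s - 1)"
proof -
  have "residue_units 2 = {1}" by (auto simp: residue_units_def) presburger
  moreover have "prime_factors (2::nat) = {2}" by (simp add: prime_prime_factors)
  ultimately have "lattice_sum s (1/2) = lattice_sum s 0 * (2 ^ s - 1)"
    using sum_lattice_sum_units[OF assms, of 2] by (simp add: jordan_totient_def algebra_simps)
  moreover have "(2::real) ^ s > 1" using assms by (intro one_less_power) auto
  ultimately show ?thesis by simp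
qed

text \<open>Since \<open>csc2 (1/2) = 1\<close>, the closed forms reduce to their coefficient sums
  \<open>1\<close>, \<open>1/3\<close> and \<open>17/315\<close>, which are divided by
  \<open>3\<close>, \<open>15\<close> and \<open>255\<close>.\<close>

lemma lattice_sum_0_values:
  "lattice_sum 2 0 = pi ^ 2 / 3" "lattice_sum 4 0 = pi ^ 4 / 45" "lattice_sum 8 0 = pi ^ 8 / 4725"
proof -
  have "(1/2 :: real) \<notin> \<int>" 
  proof
    assume "(1/2 :: real) \<in> \<int>"
    then obtain i where "1/2 = real_of_int i" by (auto elim!: Ints_cases)
    then have "real_of_int (2 * i) = of_int 1" by simp
    then have "2 * i = 1" by (simp only: of_int_eq_iff)
    then show False by presburger
  qed
  note * = lattice_sum_2[OF this] lattice_sum_4[OF this] lattice_sum_8[OF this]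
  show "lattice_sum 2 0 = pi ^ 2 / 3" "lattice_sum 4 0 = pi ^ 4 / 45" "lattice_sum 8 0 = pi ^ 8 / 4725"
    by (simp_all add: lattice_sum_0 * csc2_def)
qed

lemma sum_lattice_sum_4_squared_units:
  assumes "k \<ge> 2"
  shows "(\<Sum>a\<in>residue_units k. (lattice_sum 4 (of_int a / real k))\<^sup>2) =
    pi ^ 8 * (jordan_totient 8 k / 4725 + 2/2025 * jordan_totient 4 k + 8/567 * jordan_totient 2 k)"
proof -
  \<comment> \<open>If \<open>a / k\<close> were an integer, \<open>k\<close> would divide the unit
    \<open>a\<close>, which is impossible for \<open>k \<ge> 2\<close>.\<close>
  have "of_int a / real k \<notin> \<int>" if "a \<in> residue_units k" for a
  proof
    assume "of_int a / real k \<in> \<int>"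
    then obtain i where "of_int a / real k = of_int i" by (auto elim!: Ints_cases)
    then have "real_of_int a = of_int (i * int k)" using assms by (simp add: field_simps)
    then have "a = i * int k" by linarith
    then show False using that assms by (simp add: residue_units_def)
  qed
  then have "(\<Sum>a\<in>residue_units k. (lattice_sum 4 (of_int a / real k))\<^sup>2) =
      (\<Sum>a\<in>residue_units k. lattice_sum 8 (of_int a / real k) + 2/45 * pi ^ 4 * lattice_sum 4 (of_int a / real k)
         + 8/189 * pi ^ 6 * lattice_sum 2 (of_int a / real k))"
    by (intro sum.cong refl lattice_sum_4_squared) blast
  also have "\<dots> = lattice_sum 8 0 * jordan_totient 8 k + 2/45 * pi ^ 4 * (lattice_sum 4 0 * jordan_totient 4 k)
         + 8/189 * pi ^ 6 * (lattice_sum 2 0 * jordan_totient 2 k)"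
    using assms by (simp only: sum.distrib sum_distrib_left[symmetric]) (simp add: sum_lattice_sum_units)
  finally show ?thesis
    by (simp add: lattice_sum_0_values algebra_simps flip: power_add)
qed

section \<open>Characters of finite abelian groups\<close>

text \<open>A character of the subgroup \<open>H\<close>, encoded as a total function with arbitrary
  values off \<open>H\<close>; the value at \<open>\<one>\<close> excludes the zero
  function.\<close>

definition (in group) multiplicative_on :: "'a set \<Rightarrow> ('a \<Rightarrow> complex) \<Rightarrow> bool" where
  "multiplicative_on H f \<longleftrightarrow> f \<one> = 1 \<and> (\<forall>x\<in>H. \<forall>y\<in>H. f (x \<otimes> y) = f x * f y)"

text \<open>On the subgroup generated by \<open>H\<close> and \<open>x\<close>, the extension sends
  \<open>h \<otimes> x [^] i\<close> to \<open>f h * z ^ i\<close>. It is well defined because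
  \<open>m\<close> divides every exponent \<open>n\<close> with \<open>x [^] n \<in> H\<close>, so
  that \<open>f (x [^] n) = z ^ n\<close>.\<close>

lemma (in comm_group) extend_character:
  assumes fin: "finite (carrier G)" and H: "subgroup H G" and f: "multiplicative_on H f"
    and x: "x \<in> carrier G"
    and m: "m > 0" "x [^] m \<in> H" "\<And>j. 0 < j \<Longrightarrow> j < m \<Longrightarrow> x [^] j \<notin> H"
    and z: "z ^ m = f (x [^] m)"
  obtains H' f' where "subgroup H' G" "multiplicative_on H' f'" "H \<subseteq> H'" "x \<in> H'"
    "\<And>h. h \<in> H \<Longrightarrow> f' h = f h" "f' x = z"
proof -
  interpret H: subgroup H G by (rule H)
  have fmul: "f (u \<otimes> v) = f u * f v" if "u \<in> H" "v \<in> H" for u v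
    using f that by (auto simp: multiplicative_on_def)
  have one: "f \<one> = 1" using f by (auto simp: multiplicative_on_def)
  have fpow: "f (u [^] (n::nat)) = f u ^ n" if "u \<in> H" for u n
  proof (induction n)
    case (Suc n)
    have "u [^] n \<in> H" using that by (induction n) auto
    then show ?case using Suc that by (simp add: fmul)
  qed (simp add: one)
  \<comment> \<open>Division of \<open>n\<close> by \<open>m\<close> leaves a remainder
    \<open>r\<close> with \<open>x [^] r \<in> H\<close>; minimality of \<open>m\<close> gives
    \<open>r = 0\<close>.\<close>
  have powH: "f (x [^] n) = z ^ n" if n: "x [^] (n::nat) \<in> H" for n
  proof -
    define q r where "q = n div m" and "r = n mod m"
    have nqr: "n = m * q + r" by (simp add: q_def r_def)
    have eq: "x [^] n = (x [^] m) [^] q \<otimes> x [^] r"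
      using x by (simp add: nqr nat_pow_mult nat_pow_pow)
    have mq: "(x [^] m) [^] q \<in> H" using m(2) by (induction q) auto
    have "x [^] r = inv ((x [^] m) [^] q) \<otimes> x [^] n"
      using x unfolding eq by (simp add: m_assoc[symmetric])
    then have "x [^] r \<in> H" using mq n by simp
    then have "r = 0" using m(1) m(3)[of r] by (auto simp: r_def)
    then show ?thesis using fpow[OF m(2), of q] x z by (simp add: nqr nat_pow_pow power_mult)
  qed
  have le: "f h * z ^ i = f h' * z ^ j"
    if "h \<in> H" "h' \<in> H" "h \<otimes> x [^] i = h' \<otimes> x [^] j" "i \<le> j" for h h' and i j :: nat
  proof -
    have "h \<otimes> x [^] i = (h' \<otimes> x [^] (j - i)) \<otimes> x [^] i"
      using that x by (simp add: m_assoc nat_pow_mult)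
    then have h: "h = h' \<otimes> x [^] (j - i)" using that x by (simp add: right_cancel)
    then have "x [^] (j - i) = inv h' \<otimes> h" using that x by (simp add: m_assoc[symmetric])
    then have "x [^] (j - i) \<in> H" using that by simp
    then have "f h = f h' * z ^ (j - i)" using h that fmul powH by metis
    then show ?thesis using that(4) by (simp flip: power_add)
  qed
  have wd: "f h * z ^ i = f h' * z ^ j"
    if "h \<in> H" "h' \<in> H" "h \<otimes> x [^] i = h' \<otimes> x [^] j" for h h' and i j :: nat
    using le[of h h' i j] le[of h' h j i] that by (cases "i \<le> j") auto
  define H' where "H' = {h \<otimes> x [^] i | h (i::nat). h \<in> H}"
  \<comment> \<open>Some representation of \<open>y\<close> is chosen; \<open>wd\<close> makes the
    value independent of the choice.\<close>
  define f' where "f' = (\<lambda>y. case SOME p. y = fst p \<otimes> x [^] (snd p :: nat) \<and> fst p \<in> H of (h, i) \<Rightarrow> f h * z ^ i)"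
  have f': "f' (h \<otimes> x [^] i) = f h * z ^ i" if "h \<in> H" for h and i :: nat
  proof -
    define p where "p = (SOME p. h \<otimes> x [^] i = fst p \<otimes> x [^] (snd p :: nat) \<and> fst p \<in> H)"
    have "h \<otimes> x [^] i = fst p \<otimes> x [^] (snd p :: nat) \<and> fst p \<in> H"
      unfolding p_def by (rule someI[of _ "(h, i)"]) (use that in simp)
    then have "f h * z ^ i = f (fst p) * z ^ snd p" using wd that by blast
    then show ?thesis by (simp add: f'_def p_def case_prod_beta)
  qed
  have H'I: "h \<otimes> x [^] i \<in> H'" if "h \<in> H" for h and i :: nat
    using that by (auto simp: H'_def)
  have prod: "(h \<otimes> x [^] i) \<otimes> (h' \<otimes> x [^] j) = (h \<otimes> h') \<otimes> x [^] (i + j)"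
    if "h \<in> H" "h' \<in> H" for h h' and i j :: nat
    using that x by (simp add: nat_pow_mult[symmetric] m_ac)
  show thesis
  proof
    show "subgroup H' G"
    proof (rule subgroupI)
      show "H' \<subseteq> carrier G" using x by (auto simp: H'_def)
      show "H' \<noteq> {}" using H'I[OF H.one_closed] by auto
    next
      fix a assume "a \<in> H'"
      then obtain h and i :: nat where a: "a = h \<otimes> x [^] i" "h \<in> H" by (auto simp: H'_def)
      \<comment> \<open>Natural exponents include inverses: the inverse of \<open>x [^] i\<close> is
        \<open>x [^] (i * (N - 1))\<close>, as \<open>x [^] N = \<one>\<close>.\<close>
      define N where "N = order G"
      have N: "N > 0" using fin by (simp add: N_def order_gt_0_iff_finite)
      have "(inv h \<otimes> x [^] (i * (N - 1))) \<otimes> a = (inv h \<otimes> h) \<otimes> x [^] (i * (N - 1) + i)"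
        using a prod by simp
      also have "i * (N - 1) + i = N * i" using N by (cases N) (auto simp: algebra_simps)
      also have "x [^] (N * i) = \<one>" using x by (simp add: nat_pow_pow[symmetric] N_def pow_order_eq_1)
      finally have "inv a = inv h \<otimes> x [^] (i * (N - 1))"
        using a x by (intro inv_equality) auto
      then show "inv a \<in> H'" using a H'I by simp
    next
      fix a b assume "a \<in> H'" "b \<in> H'"
      then obtain h h' and i j :: nat where "a = h \<otimes> x [^] i" "h \<in> H" "b = h' \<otimes> x [^] j" "h' \<in> H"
        by (auto simp: H'_def)
      then show "a \<otimes> b \<in> H'" using prod H'I by simp
    qed
    have sub: "f' h = f h" "h \<in> H'" if "h \<in> H" for h
      using f'[OF that, of 0] H'I[OF that, of 0] that by auto
    then show "\<And>h. h \<in> H \<Longrightarrow> f' h = f h" "H \<subseteq> H'" by auto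
    show "x \<in> H'" "f' x = z"
      using f'[OF H.one_closed, of 1] H'I[OF H.one_closed, of 1] x one by auto
    show "multiplicative_on H' f'"
      unfolding multiplicative_on_def
    proof (intro conjI ballI)
      show "f' \<one> = 1" using sub one by simp
      fix a b assume "a \<in> H'" "b \<in> H'"
      then obtain h h' and i j :: nat where "a = h \<otimes> x [^] i" "h \<in> H" "b = h' \<otimes> x [^] j" "h' \<in> H"
        by (auto simp: H'_def)
      then show "f' (a \<otimes> b) = f' a * f' b"
        using prod f' fmul by (simp add: power_add)
    qed
  qed
qed

text \<open>The group order is an admissible exponent, since it sends \<open>x\<close> to
  \<open>\<one>\<close>.\<close>

lemma (in comm_group) least_power_in_subgroup:
  assumes fin: "finite (carrier G)" and H: "subgroup H G" and x: "x \<in> carrier G"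
  obtains m :: nat where "m > 0" "x [^] m \<in> H" "\<And>j. 0 < j \<Longrightarrow> j < m \<Longrightarrow> x [^] j \<notin> H"
proof -
  define P where "P = (\<lambda>m::nat. 0 < m \<and> x [^] m \<in> H)"
  have "P (order G)"
    using fin H x by (simp add: P_def order_gt_0_iff_finite pow_order_eq_1 subgroup.one_closed)
  then have "P (Least P)" by (rule LeastI)
  then show thesis using not_less_Least[of _ P] by (intro that[of "Least P"]) (auto simp: P_def)
qed

text \<open>A character with value other than 1 at \<open>a\<close> is built on the cyclic group of
  \<open>a\<close> and then extended by one element at a time; finiteness makes the process end at
  the whole group.\<close>

lemma (in comm_group) separating_character:
  assumes fin: "finite (carrier G)" and a: "a \<in> carrier G" "a \<noteq> \<one>"
  shows "\<exists>f. multiplicative_on (carrier G) f \<and> f a \<noteq> 1"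
proof -
  have ext: "\<exists>g. multiplicative_on (carrier G) g \<and> g a \<noteq> 1"
    if "subgroup H G" "multiplicative_on H f" "a \<in> H" "f a \<noteq> 1" for H f
    using that
  proof (induction "card (carrier G - H)" arbitrary: H f rule: less_induct)
    case less
    have HG: "H \<subseteq> carrier G" using less.prems(1) by (rule subgroup.subset)
    show ?case
    proof (cases "H = carrier G")
      case False
      then obtain x where x: "x \<in> carrier G" "x \<notin> H" using HG by auto
      obtain m :: nat where m: "m > 0" "x [^] m \<in> H" "\<And>j. 0 < j \<Longrightarrow> j < m \<Longrightarrow> x [^] j \<notin> H"
        using least_power_in_subgroup[OF fin less.prems(1) x(1)] by blast
      \<comment> \<open>Characters take nonzero values on group elements, and a nonzero complex
        number has \<open>m\<close> distinct \<open>m\<close>-th roots.\<close>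
      have "f (x [^] m) \<noteq> 0"
      proof -
        have "inv (x [^] m) \<in> H" using m(2) less.prems(1) by (simp add: subgroup.m_inv_closed)
        then have "f (x [^] m) * f (inv (x [^] m)) = f (x [^] m \<otimes> inv (x [^] m))"
          using m(2) less.prems(2) by (simp only: multiplicative_on_def)
        also have "\<dots> = 1" using x less.prems(2) by (simp add: multiplicative_on_def)
        finally show ?thesis by auto
      qed
      then have "card {z. z ^ m = f (x [^] m)} > 0" using m(1) by (simp add: card_nth_roots)
      then obtain z where z: "z ^ m = f (x [^] m)" by (auto simp: card_gt_0_iff)
      obtain H' f' where H': "subgroup H' G" "multiplicative_on H' f'" "H \<subseteq> H'" "x \<in> H'"
        "\<And>h. h \<in> H \<Longrightarrow> f' h = f h"
        using extend_character[OF fin less.prems(1,2) x(1) m z] by blast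
      show ?thesis
      proof (rule less.hyps[OF _ H'(1,2)])
        show "card (carrier G - H') < card (carrier G - H)"
          using H' x fin by (intro psubset_card_mono) auto
      qed (use H' less.prems in auto)
    qed (use less.prems in auto)
  qed
  have triv: "subgroup {\<one>} G" by (rule triv_subgroup)
  have triv_f: "multiplicative_on {\<one>} (\<lambda>_. 1)" by (simp add: multiplicative_on_def)
  obtain m :: nat where m: "m > 0" "a [^] m \<in> {\<one>}" "\<And>j. 0 < j \<Longrightarrow> j < m \<Longrightarrow> a [^] j \<notin> {\<one>}"
    using least_power_in_subgroup[OF fin triv a(1)] by blast
  \<comment> \<open>Over the trivial subgroup \<open>m\<close> is the order of \<open>a\<close>,
    hence at least 2, and there is an \<open>m\<close>-th root of unity other than 1.\<close>
  have "m \<noteq> 1" using m(2) a by auto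
  then have "card {z::complex. z ^ m = 1} \<ge> 2" using m(1) by (simp add: card_roots_unity_eq)
  then obtain z :: complex where z: "z ^ m = 1" "z \<noteq> 1"
    by (metis (mono_tags, lifting) One_nat_def card_2_iff' card_le_Suc0_iff_eq mem_Collect_eq
        not_less_eq_eq numeral_2_eq_2 card.infinite nat.simps(3) le_zero_eq)
  show ?thesis
    by (rule extend_character[OF fin triv triv_f a(1) m, of z]) (use z ext in auto)
qed

section \<open>Orthogonality of Dirichlet characters\<close>

context
  fixes k :: nat and chi :: "int \<Rightarrow> complex"
  assumes chi: "dirichlet_character k chi"
begin

lemma character_mult: "chi (m * n) = chi m * chi n"
  using chi by (simp add: dirichlet_character_def)

lemma character_nonzero_iff: "chi n \<noteq> 0 \<longleftrightarrow> coprime n (int k)"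
  using chi by (simp add: dirichlet_character_def)

lemma character_one: "chi 1 = 1"
  using character_mult[of 1 1] character_nonzero_iff[of 1] by simp

lemma character_power: "chi (m ^ n) = chi m ^ n"
  by (induction n) (auto simp: character_one character_mult)

lemma character_add_mult: "chi (n + int k * i) = chi n"
proof -
  have step: "chi (n + int k) = chi n" for n using chi by (simp add: dirichlet_character_def)
  show ?thesis
  proof (induction i rule: int_induct[where k = 0])
    case (step1 i)
    then show ?case using step[of "n + int k * i"] by (simp add: algebra_simps)
  next
    case (step2 i)
    then show ?case using step[of "n + int k * (i - 1)"] by (simp add: algebra_simps)
  qed simp
qed

lemma character_cong:
  assumes "[m = n] (mod int k)"
  shows "chi m = chi n"
  using assms character_add_mult by (metis cong_iff_lin)

lemma character_mod: "chi (n mod int k) = chi n"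
  by (rule character_cong) simp

lemma character_root_of_unity:
  assumes "k \<ge> 2" "coprime n (int k)"
  shows "chi n ^ totient k = 1"
proof -
  have "residues (int k)" using assms by unfold_locales auto
  then have "[n ^ totient (nat (int k)) = 1] (mod int k)"
    using assms(2) by (rule residues.euler_theorem)
  then show ?thesis using character_cong character_one by (simp flip: character_power)
qed

lemma character_norm:
  assumes "k \<ge> 2" "coprime n (int k)"
  shows "norm (chi n) = 1"
proof -
  have "norm (chi n) ^ totient k = 1"
    using character_root_of_unity[OF assms] by (simp flip: norm_power)
  then show ?thesis using assms(1) power_eq_iff_eq_base[of "totient k" "norm (chi n)" 1] by simp
qed

lemma character_mult_cnj:
  assumes "k \<ge> 2" "coprime n (int k)"
  shows "chi n * cnj (chi n) = 1"
  using character_norm[OF assms] by (simp add: complex_norm_square[symmetric])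

end

text \<open>By periodicity a character is determined on \<open>{0..<int k}\<close>, and there each
  value is 0 or one of finitely many roots of unity.\<close>

lemma finite_dirichlet_characters:
  assumes "k \<ge> 2"
  shows "finite {chi. dirichlet_character k chi}"
proof (rule finite_imageD)
  let ?R = "\<lambda>chi :: int \<Rightarrow> complex. restrict chi {0..<int k}"
  have "?R ` {chi. dirichlet_character k chi} \<subseteq> PiE {0..<int k} (\<lambda>_. {0} \<union> {z. z ^ totient k = 1})"
    using character_nonzero_iff character_root_of_unity assms by fastforce
  moreover have "finite (PiE {0..<int k} (\<lambda>_. {0} \<union> {z::complex. z ^ totient k = 1}))"
    using assms by (intro finite_PiE) (auto intro: finite_roots_unity)
  ultimately show "finite (?R ` {chi. dirichlet_character k chi})" by (rule finite_subset)
  show "inj_on ?R {chi. dirichlet_character k chi}"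
  proof (rule inj_onI, clarify, rule ext)
    fix chi psi n
    assume c: "dirichlet_character k chi" "dirichlet_character k psi" "?R chi = ?R psi"
    have "n mod int k \<in> {0..<int k}" using assms by simp
    then have "chi (n mod int k) = psi (n mod int k)" using c(3) by (metis restrict_apply')
    then show "chi n = psi n" by (simp add: character_mod[OF c(1)] character_mod[OF c(2)])
  qed
qed

lemma coprime_add_modulus: "coprime (n + int k) (int k) \<longleftrightarrow> coprime n (int k)"
  by (simp add: coprime_iff_gcd_eq_1)

text \<open>A character of the unit group of the residue ring, extended by 0 to the non-units, is a
  Dirichlet character.\<close>

lemma separating_dirichlet_character:
  assumes k: "k \<ge> 2" and a: "coprime a (int k)" "\<not> [a = 1] (mod int k)"
  obtains chi where "dirichlet_character k chi" "chi a \<noteq> 1"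
proof -
  interpret residues "int k" "residue_ring (int k)" by unfold_locales (use k in auto)
  let ?R = "residue_ring (int k)"
  interpret U: comm_group "units_of ?R" by (rule units_comm_group)
  have mem: "n mod int k \<in> carrier (units_of ?R)" if "coprime n (int k)" for n
    using that k by (simp add: units_of_carrier)
  have mul: "(m mod int k) \<otimes>\<^bsub>units_of ?R\<^esub> (n mod int k) = (m * n) mod int k" for m n
    by (simp add: units_of_mult mult_cong)
  have one: "\<one>\<^bsub>units_of ?R\<^esub> = 1" by (simp add: units_of_one res_one_eq)
  have fin: "finite (carrier (units_of ?R))" by (simp add: units_of_carrier)
  have "a mod int k \<noteq> \<one>\<^bsub>units_of ?R\<^esub>" using a(2) k by (simp add: one cong_def)
  from U.separating_character[OF fin mem[OF a(1)] this] obtain f where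
    f: "U.multiplicative_on (carrier (units_of ?R)) f" "f (a mod int k) \<noteq> 1" by blast
  have f1: "f 1 = 1" and fmul: "f ((m * n) mod int k) = f (m mod int k) * f (n mod int k)"
    if "coprime m (int k)" "coprime n (int k)" for m n
    using f(1) mem that unfolding U.multiplicative_on_def by (auto simp: one simp flip: mul)
  have nz: "f (n mod int k) \<noteq> 0" if n: "coprime n (int k)" for n
  proof -
    obtain c where c: "[n * c = 1] (mod int k)" using cong_solve_coprime_int[OF n] by blast
    then have "coprime (n * c) (int k)" by (metis cong_imp_coprime cong_sym coprime_1_left)
    then have "coprime c (int k)" by simp
    from fmul[OF n this] f1[OF n this] c k show ?thesis by (auto simp: cong_def)
  qed
  show thesis
  proof
    show "dirichlet_character k (\<lambda>n. if coprime n (int k) then f (n mod int k) else 0)"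
      unfolding dirichlet_character_def using fmul nz by (auto simp: coprime_add_modulus)
    show "(if coprime a (int k) then f (a mod int k) else 0) \<noteq> 1" using a f by simp
  qed
qed

lemma finite_residue_units: "finite (residue_units k)"
  by (rule finite_subset[of _ "{0..<int k}"]) (auto simp: residue_units_def)

lemma residue_units_pos:
  assumes "k \<ge> 2" "a \<in> residue_units k"
  shows "a > 0"
proof -
  have "a \<noteq> 0"
  proof
    assume "a = 0"
    then show False using assms by (simp add: residue_units_def)
  qed
  then show ?thesis using assms(2) by (simp add: residue_units_def)
qed

lemma residue_units_cong_iff:
  assumes "a \<in> residue_units k" "b \<in> residue_units k"
  shows "[a = b] (mod int k) \<longleftrightarrow> b = a"
  using assms by (auto simp: residue_units_def cong_def)

lemma residue_units_bij:
  assumes "k \<ge> 2" "coprime b (int k)"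
  shows "bij_betw (\<lambda>a. a * b mod int k) (residue_units k) (residue_units k)"
proof -
  have fin: "finite (residue_units k)" by (rule finite_residue_units)
  have inj: "inj_on (\<lambda>a. a * b mod int k) (residue_units k)"
  proof (rule inj_onI)
    fix x y assume xy: "x \<in> residue_units k" "y \<in> residue_units k" "x * b mod int k = y * b mod int k"
    then have "[x * b = y * b] (mod int k)" by (simp add: cong_def)
    then have "[x = y] (mod int k)" using assms(2) by (simp add: cong_mult_rcancel)
    then show "x = y" using xy residue_units_cong_iff by blast
  qed
  have "(\<lambda>a. a * b mod int k) ` residue_units k \<subseteq> residue_units k"
    using assms by (auto simp: residue_units_def)
  then show ?thesis using inj fin endo_inj_surj unfolding bij_betw_def by blast
qed

lemma card_residue_units:
  assumes "k \<ge> 2"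
  shows "card (residue_units k) = totient k"
proof -
  interpret residues "int k" "residue_ring (int k)" by unfold_locales (use assms in auto)
  have "residue_units k = Units (residue_ring (int k))"
    using residue_units_pos[OF assms] by (auto simp: residue_units_def res_units_eq)
  then show ?thesis using totient_eq by simp
qed

section \<open>Orthogonality relations and the number of characters\<close>

text \<open>Multiplication by a fixed character \<open>psi\<close> permutes all characters and
  scales the sum by \<open>psi a * cnj (psi b)\<close>. For \<open>psi\<close> separating
  \<open>a\<close> from \<open>b\<close> this factor is not 1, so the sum is 0.\<close>

lemma sum_dirichlet_characters_distinct:
  assumes k: "k \<ge> 2" and ab: "coprime a (int k)" "coprime b (int k)" "\<not> [a = b] (mod int k)"
  shows "(\<Sum>chi | dirichlet_character k chi. chi a * cnj (chi b)) = 0"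
proof -
  let ?D = "{chi. dirichlet_character k chi}"
  let ?S = "\<Sum>chi\<in>?D. chi a * cnj (chi b)"
  \<comment> \<open>With \<open>c\<close> inverse to \<open>b\<close>, the factor becomes
    \<open>psi (a * c)\<close>, as \<open>cnj (psi b) = psi c\<close>; and \<open>a * c\<close> is
    not congruent to 1.\<close>
  obtain c where c: "[b * c = 1] (mod int k)" using cong_solve_coprime_int[OF ab(2)] by blast
  then have "coprime (b * c) (int k)" by (metis cong_imp_coprime cong_sym coprime_1_left)
  then have cc: "coprime c (int k)" by simp
  have "\<not> [a * c = 1] (mod int k)"
  proof
    assume "[a * c = 1] (mod int k)"
    then have "[a * c = b * c] (mod int k)" using c by (metis cong_sym cong_trans)
    then show False using cc ab(3) by (simp add: cong_mult_rcancel)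
  qed
  then obtain psi where psi: "dirichlet_character k psi" "psi (a * c) \<noteq> 1"
    using separating_dirichlet_character[OF k, of "a * c"] ab(1) cc by auto
  have "psi b * psi c = 1"
    using character_cong[OF psi(1) c] character_one[OF psi(1)] by (simp add: character_mult[OF psi(1)])
  then have "cnj (psi b) = cnj (psi b) * (psi b * psi c)" by simp
  also have "\<dots> = (psi b * cnj (psi b)) * psi c" by (simp only: mult_ac)
  also have "\<dots> = psi c" using character_mult_cnj[OF psi(1) k ab(2)] by simp
  finally have w: "psi a * cnj (psi b) \<noteq> 1" using psi(2) by (simp add: character_mult[OF psi(1)])
  have inj: "inj_on (\<lambda>chi n. psi n * chi n) ?D"
  proof (rule inj_onI, clarify, rule ext)
    fix chi chi' n
    assume h: "dirichlet_character k chi" "dirichlet_character k chi'" "(\<lambda>n. psi n * chi n) = (\<lambda>n. psi n * chi' n)"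
    show "chi n = chi' n"
    proof (cases "coprime n (int k)")
      case True
      then show ?thesis using character_nonzero_iff[OF psi(1), of n] fun_cong[OF h(3), of n] by simp
    next
      case False
      then show ?thesis using character_nonzero_iff[OF h(1), of n] character_nonzero_iff[OF h(2), of n] by simp
    qed
  qed
  have "(\<lambda>chi n. psi n * chi n) ` ?D \<subseteq> ?D"
    using psi(1) by (auto simp: dirichlet_character_def)
  then have bij: "bij_betw (\<lambda>chi n. psi n * chi n) ?D ?D"
    using inj finite_dirichlet_characters[OF k] endo_inj_surj unfolding bij_betw_def by blast
  have "?S = (\<Sum>chi\<in>?D. psi a * chi a * cnj (psi b * chi b))"
    using sum.reindex_bij_betw[OF bij, of "\<lambda>chi. chi a * cnj (chi b)"] by simp
  also have "\<dots> = (psi a * cnj (psi b)) * ?S" by (simp add: sum_distrib_left mult_ac)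
  finally show ?thesis using w by simp
qed

lemma sum_units_nonprincipal:
  assumes k: "k \<ge> 2" and chi: "dirichlet_character k chi" and b: "coprime b (int k)" "chi b \<noteq> 1"
  shows "(\<Sum>a\<in>residue_units k. chi a) = 0"
proof -
  have "(\<Sum>a\<in>residue_units k. chi a) = (\<Sum>a\<in>residue_units k. chi (a * b mod int k))"
    by (rule sum.reindex_bij_betw[OF residue_units_bij[OF k b(1)], symmetric])
  also have "\<dots> = (\<Sum>a\<in>residue_units k. chi a) * chi b"
    by (simp add: character_mod[OF chi] character_mult[OF chi] sum_distrib_right)
  finally show ?thesis using b(2) by simp
qed

text \<open>The sum of \<open>chi a\<close> over all characters and units is evaluated twice.
  Summing over characters first leaves only \<open>a = 1\<close> and gives their number; summing
  over units first leaves only the principal character \<open>chi0\<close> and gives the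
  totient.\<close>

lemma card_dirichlet_characters:
  assumes k: "k \<ge> 2"
  shows "card {chi. dirichlet_character k chi} = totient k"
proof -
  let ?D = "{chi. dirichlet_character k chi}"
  define chi0 :: "int \<Rightarrow> complex" where "chi0 = (\<lambda>n. if coprime n (int k) then 1 else 0)"
  have chi0: "dirichlet_character k chi0" by (auto simp: dirichlet_character_def chi0_def coprime_add_modulus)
  have finU: "finite (residue_units k)" by (rule finite_residue_units)
  have one: "1 \<in> residue_units k" using k by (simp add: residue_units_def)
  have col: "(\<Sum>chi\<in>?D. chi a) = (if a = 1 then of_nat (card ?D) else 0)" if a: "a \<in> residue_units k" for a
  proof -
    have "(\<Sum>chi\<in>?D. chi a) = (\<Sum>chi\<in>?D. chi a * cnj (chi 1))"
      by (intro sum.cong refl) (simp add: character_one)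
    moreover have "\<not> [a = 1] (mod int k)" if "a \<noteq> 1"
      using that a one residue_units_cong_iff by blast
    moreover have "(\<Sum>chi\<in>?D. chi 1 * cnj (chi 1)) = of_nat (card ?D)"
      by (simp add: character_one)
    ultimately show ?thesis
      using sum_dirichlet_characters_distinct[OF k, of a 1] a by (auto simp: residue_units_def)
  qed
  have row: "(\<Sum>a\<in>residue_units k. chi a) = (if chi = chi0 then of_nat (totient k) else 0)" if "chi \<in> ?D" for chi
  proof (cases "chi = chi0")
    case True
    have "(\<Sum>a\<in>residue_units k. chi0 a) = (\<Sum>a\<in>residue_units k. 1)"
      by (intro sum.cong) (auto simp: chi0_def residue_units_def)
    then show ?thesis using True card_residue_units[OF k] by simp
  next
    case False
    then obtain b where "chi b \<noteq> chi0 b" by blast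
    then have "coprime b (int k) \<and> chi b \<noteq> 1"
      using character_nonzero_iff[of k chi b] that by (auto simp: chi0_def split: if_splits)
    then show ?thesis using sum_units_nonprincipal[OF k, of chi b] that False by simp
  qed
  have "complex_of_nat (card ?D) = (\<Sum>a\<in>residue_units k. if a = 1 then of_nat (card ?D) else 0)"
    using finU one by (simp add: sum.delta)
  also have "\<dots> = (\<Sum>a\<in>residue_units k. \<Sum>chi\<in>?D. chi a)"
    by (intro sum.cong refl) (simp add: col)
  also have "\<dots> = (\<Sum>chi\<in>?D. \<Sum>a\<in>residue_units k. chi a)" by (rule sum.swap)
  also have "\<dots> = (\<Sum>chi\<in>?D. if chi = chi0 then of_nat (totient k) else 0)"
    by (intro sum.cong refl) (simp add: row)
  also have "\<dots> = of_nat (totient k)"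
    using finite_dirichlet_characters[OF k] chi0 by (simp add: sum.delta)
  finally show ?thesis by (simp only: of_nat_eq_iff)
qed

lemma dirichlet_character_orthogonality:
  assumes k: "k \<ge> 2" and ab: "coprime a (int k)" "coprime b (int k)"
  shows "(\<Sum>chi | dirichlet_character k chi. chi a * cnj (chi b)) =
    (if [a = b] (mod int k) then of_nat (totient k) else 0)"
proof (cases "[a = b] (mod int k)")
  case True
  have "(\<Sum>chi | dirichlet_character k chi. chi a * cnj (chi b)) = (\<Sum>chi | dirichlet_character k chi. 1)"
    using k ab True by (intro sum.cong refl) (metis character_cong character_mult_cnj mem_Collect_eq)
  then show ?thesis using True card_dirichlet_characters[OF k] by simp
qed (use sum_dirichlet_characters_distinct[OF assms] in simp)

text \<open>As \<open>chi (-1)\<close> is 1 or -1, the factor \<open>(1 + chi (-1)) / 2\<close>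
  detects even characters; the relation is the average of the full ones for \<open>a\<close> and
  \<open>- a\<close>.\<close>

lemma even_dirichlet_character_orthogonality:
  assumes k: "k \<ge> 2" and ab: "coprime a (int k)" "coprime b (int k)"
  shows "(\<Sum>chi\<in>even_dirichlet_characters k. chi a * cnj (chi b)) = of_nat (totient k) / 2 *
    ((if [a = b] (mod int k) then 1 else 0) + (if [- a = b] (mod int k) then 1 else 0))"
proof -
  let ?D = "{chi. dirichlet_character k chi}"
  have "(\<Sum>chi\<in>even_dirichlet_characters k. chi a * cnj (chi b)) =
      (\<Sum>chi\<in>?D. if chi (-1) = 1 then chi a * cnj (chi b) else 0)"
    using finite_dirichlet_characters[OF k]
    by (simp add: even_dirichlet_characters_def sum.If_cases Int_def)
  also have "\<dots> = (\<Sum>chi\<in>?D. (chi a * cnj (chi b) + chi (- a) * cnj (chi b)) / 2)"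
  proof (intro sum.cong refl)
    fix chi assume "chi \<in> ?D"
    then have chi: "dirichlet_character k chi" by simp
    have "(chi (-1))\<^sup>2 = 1"
      using character_mult[OF chi, of "-1" "-1"] character_one[OF chi] by (simp add: power2_eq_square)
    then have "chi (-1) = 1 \<or> chi (-1) = -1" by (simp add: power2_eq_1_iff)
    moreover have "chi (- a) = chi (-1) * chi a" using character_mult[OF chi, of "-1" a] by simp
    ultimately show "(if chi (-1) = 1 then chi a * cnj (chi b) else 0) =
        (chi a * cnj (chi b) + chi (- a) * cnj (chi b)) / 2" by auto
  qed
  also have "\<dots> = ((\<Sum>chi\<in>?D. chi a * cnj (chi b)) + (\<Sum>chi\<in>?D. chi (- a) * cnj (chi b))) / 2"
    by (simp add: sum.distrib sum_divide_distrib[symmetric])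
  finally show ?thesis
    using dirichlet_character_orthogonality[OF k ab] dirichlet_character_orthogonality[OF k, of "- a" b] ab
    by (simp add: add_divide_distrib)
qed

section \<open>The mean square\<close>

text \<open>Absolute convergence turns the ordered series with \<open>powr\<close> into an unordered
  sum with ordinary powers, whose terms may be regrouped.\<close>

lemma dirichlet_L_4_has_sum:
  assumes k: "k \<ge> 2" and chi: "dirichlet_character k chi"
  shows "((\<lambda>n. chi (int (Suc n)) * of_real (1 / real (Suc n) ^ 4)) has_sum dirichlet_L 4 chi) UNIV"
proof (rule norm_summable_imp_has_sum)
  let ?t = "\<lambda>n. chi (int (Suc n)) * of_real (1 / real (Suc n) ^ 4)"
  have "summable (\<lambda>n. 1 / real n ^ 4)"
    using inverse_power_summable[of 4, where ?'a = real] by (simp add: inverse_eq_divide)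
  then have s: "summable (\<lambda>n. 1 / real (Suc n) ^ 4)" by (subst summable_Suc_iff)
  have le: "norm (?t n) \<le> 1 / real (Suc n) ^ 4" for n
  proof -
    have "norm (chi (int (Suc n))) \<le> 1"
      using character_norm[OF chi k, of "int (Suc n)"] character_nonzero_iff[OF chi, of "int (Suc n)"]
      by (cases "coprime (int (Suc n)) (int k)") auto
    then have "norm (chi (int (Suc n))) * (1 / real (Suc n) ^ 4) \<le> 1 * (1 / real (Suc n) ^ 4)"
      by (rule mult_right_mono) simp
    then show ?thesis by (simp add: norm_mult norm_divide norm_power del: of_nat_Suc)
  qed
  show sn: "summable (\<lambda>n. norm (?t n))"
    by (rule summable_comparison_test'[OF s, of 0]) (use le in simp)
  have "of_nat (Suc n) powr (- 4) = complex_of_real (1 / real (Suc n) ^ 4)" for n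
  proof -
    have "of_nat (Suc n) powr (- 4) = inverse (of_nat (Suc n) powr (of_nat 4 :: complex))"
      by (subst powr_minus) simp
    also have "\<dots> = inverse (of_nat (Suc n) ^ 4)"
      by (subst powr_nat') auto
    finally show ?thesis by (simp add: inverse_eq_divide)
  qed
  then have "dirichlet_L 4 chi = suminf ?t" by (simp only: dirichlet_L_def)
  moreover have "summable ?t" using sn by (rule summable_norm_cancel)
  ultimately show "?t sums dirichlet_L 4 chi" by (simp only: summable_sums)
qed

lemma dirichlet_L_4_even:
  assumes k: "k \<ge> 2" and chi: "chi \<in> even_dirichlet_characters k"
  shows "2 * real k ^ 4 * dirichlet_L 4 chi =
    (\<Sum>a\<in>residue_units k. chi a * of_real (lattice_sum 4 (of_int a / real k)))"
proof -
  have d: "dirichlet_character k chi" and ev: "chi (-1) = 1"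
    using chi by (auto simp: even_dirichlet_characters_def)
  let ?f = "\<lambda>N::int. chi N * of_real (1 / of_int N ^ 4)"
  have neg: "chi (- N) = chi N" for N using character_mult[OF d, of "-1" N] ev by simp
  note L = dirichlet_L_4_has_sum[OF k d]
  \<comment> \<open>The term at 0 vanishes because \<open>1 / 0 = 0\<close>, and by evenness the
    negative integers contribute a second copy of the L-value.\<close>
  have "(?f has_sum (?f 0 + (dirichlet_L 4 chi + dirichlet_L 4 chi))) UNIV"
  proof (rule has_sum_int_split)
    show "((\<lambda>n. ?f (int (Suc n))) has_sum dirichlet_L 4 chi) UNIV" using L by (simp only: of_int_of_nat_eq)
    have "?f (- int (Suc n)) = chi (int (Suc n)) * of_real (1 / real (Suc n) ^ 4)" for n
      by (simp only: neg of_int_minus of_int_of_nat_eq power_minus_even even_numeral)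
    then show "((\<lambda>n. ?f (- int (Suc n))) has_sum dirichlet_L 4 chi) UNIV" using L by (simp only:)
  qed
  then have 1: "(?f has_sum (2 * dirichlet_L 4 chi)) UNIV" by simp
  let ?E = "\<lambda>j. lattice_sum 4 (of_int j / real k)"
  have 2: "(?f has_sum (\<Sum>j\<in>{0..<int k}. chi j * of_real (1 / real k ^ 4 * ?E j))) UNIV"
  proof (rule has_sum_residue_classes)
    fix j
    have "real_of_int (j + int k * m) = real k * (of_int j / real k + of_int m)" for m
      using k by (simp add: field_simps)
    then have "1 / real_of_int (j + int k * m) ^ 4 = 1 / real k ^ 4 * (1 / (of_int j / real k + of_int m) ^ 4)" for m
      by (simp add: power_mult_distrib)
    then have eq: "?f (j + int k * m) = chi j * of_real (1 / real k ^ 4 * (1 / (of_int j / real k + of_int m) ^ 4))" for m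
      by (simp only: character_add_mult[OF d])
    show "((\<lambda>m. ?f (j + int k * m)) has_sum chi j * of_real (1 / real k ^ 4 * ?E j)) UNIV"
      unfolding eq by (intro has_sum_cmult_right has_sum_of_real has_sum_lattice_sum) simp
  qed (use k in simp)
  have "2 * dirichlet_L 4 chi = (\<Sum>j\<in>{0..<int k}. chi j * of_real (1 / real k ^ 4 * ?E j))"
    by (rule has_sum_unique[OF 1 2])
  \<comment> \<open>Residues not coprime to \<open>k\<close> drop out, as \<open>chi\<close>
    vanishes there.\<close>
  also have "\<dots> = (\<Sum>j\<in>residue_units k. chi j * of_real (1 / real k ^ 4 * ?E j))"
    using character_nonzero_iff[OF d] by (intro sum.mono_neutral_right) (auto simp: residue_units_def)
  also have "\<dots> = of_real (1 / real k ^ 4) * (\<Sum>j\<in>residue_units k. chi j * of_real (?E j))"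
    by (simp only: sum_distrib_left of_real_mult mult_ac)
  finally have *: "2 * dirichlet_L 4 chi = of_real (1 / real k ^ 4) * (\<Sum>j\<in>residue_units k. chi j * of_real (?E j))" .
  have "2 * real k ^ 4 * dirichlet_L 4 chi = real k ^ 4 * (2 * dirichlet_L 4 chi)" by simp
  also have "\<dots> = (\<Sum>j\<in>residue_units k. chi j * of_real (?E j))" unfolding * using k by simp
  finally show ?thesis .
qed

text \<open>Expanding the square and summing over characters first leaves, for each
  \<open>a\<close>, only \<open>b = a\<close> and \<open>b = int k - a\<close>, each with weight
  half the totient. The symmetry of \<open>E\<close> makes both contribute
  \<open>(E a)\<^sup>2\<close>.\<close>

lemma sum_even_characters_parseval:
  assumes k: "k \<ge> 2" and E: "\<And>a. a \<in> residue_units k \<Longrightarrow> E (int k - a) = (E a :: real)"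
  shows "(\<Sum>chi\<in>even_dirichlet_characters k. (norm (\<Sum>a\<in>residue_units k. chi a * of_real (E a)))\<^sup>2) =
    real (totient k) * (\<Sum>a\<in>residue_units k. (E a)\<^sup>2)"
proof -
  let ?U = "residue_units k"
  let ?X = "even_dirichlet_characters k"
  have fin: "finite ?U" by (rule finite_residue_units)
  have sq: "complex_of_real ((norm (\<Sum>a\<in>?U. chi a * of_real (E a)))\<^sup>2) =
      (\<Sum>a\<in>?U. \<Sum>b\<in>?U. of_real (E a * E b) * (chi a * cnj (chi b)))" for chi :: "int \<Rightarrow> complex"
    unfolding complex_norm_square by (simp add: sum_product mult_ac)
  have inner: "(\<Sum>b\<in>?U. of_real (E a * E b) * (\<Sum>chi\<in>?X. chi a * cnj (chi b))) =
      complex_of_real (real (totient k) * (E a)\<^sup>2)" if a: "a \<in> ?U" for a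
  proof -
    have ka: "int k - a \<in> ?U"
    proof -
      have "coprime (int k - a) (int k)"
        using a coprime_add_modulus[of "- a" k] by (simp add: residue_units_def)
      then show ?thesis using a residue_units_pos[OF k a] by (simp add: residue_units_def)
    qed
    have orth: "(\<Sum>chi\<in>?X. chi a * cnj (chi b)) = of_nat (totient k) / 2 *
        ((if b = a then 1 else 0) + (if b = int k - a then 1 else 0))" if b: "b \<in> ?U" for b
    proof -
      have "[a = b] (mod int k) \<longleftrightarrow> b = a" using a b by (rule residue_units_cong_iff)
      moreover have "[- a = b] (mod int k) \<longleftrightarrow> b = int k - a"
      proof -
        have "[- a = b] (mod int k) \<longleftrightarrow> [int k - a = b] (mod int k)" by (simp add: cong_def)
        also have "\<dots> \<longleftrightarrow> b = int k - a" using ka b by (rule residue_units_cong_iff)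
        finally show ?thesis .
      qed
      ultimately show ?thesis
        using even_dirichlet_character_orthogonality[OF k, of a b] a b by (simp add: residue_units_def)
    qed
    have "(\<Sum>b\<in>?U. of_real (E a * E b) * (\<Sum>chi\<in>?X. chi a * cnj (chi b))) =
       (\<Sum>b\<in>?U. of_nat (totient k) / 2 * ((if b = a then of_real (E a * E b) else 0) +
          (if b = int k - a then of_real (E a * E b) else 0)))"
      by (rule sum.cong[OF refl]) (simp only: orth, simp add: algebra_simps)
    also have "\<dots> = of_nat (totient k) / 2 * ((\<Sum>b\<in>?U. if b = a then of_real (E a * E b) else 0) +
          (\<Sum>b\<in>?U. if b = int k - a then of_real (E a * E b) else 0))"
      by (simp only: sum_distrib_left[symmetric] sum.distrib)
    also have "\<dots> = of_nat (totient k) / 2 * (of_real (E a * E a) + of_real (E a * E (int k - a)))"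
      using fin a ka by simp
    finally show ?thesis using E[OF a] by (simp add: power2_eq_square)
  qed
  have "complex_of_real (\<Sum>chi\<in>?X. (norm (\<Sum>a\<in>?U. chi a * of_real (E a)))\<^sup>2) =
      (\<Sum>chi\<in>?X. \<Sum>a\<in>?U. \<Sum>b\<in>?U. of_real (E a * E b) * (chi a * cnj (chi b)))"
    unfolding of_real_sum sq ..
  also have "\<dots> = (\<Sum>a\<in>?U. \<Sum>chi\<in>?X. \<Sum>b\<in>?U. of_real (E a * E b) * (chi a * cnj (chi b)))"
    by (rule sum.swap)
  also have "\<dots> = (\<Sum>a\<in>?U. \<Sum>b\<in>?U. \<Sum>chi\<in>?X. of_real (E a * E b) * (chi a * cnj (chi b)))"
    by (intro sum.cong refl sum.swap)
  also have "\<dots> = (\<Sum>a\<in>?U. complex_of_real (real (totient k) * (E a)\<^sup>2))"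
    unfolding sum_distrib_left[symmetric] by (intro sum.cong refl inner)
  also have "\<dots> = complex_of_real (real (totient k) * (\<Sum>a\<in>?U. (E a)\<^sup>2))"
    by (simp only: of_real_sum[symmetric] sum_distrib_left[symmetric])
  finally show ?thesis by (simp only: of_real_eq_iff)
qed

theorem theorem3p2:
  fixes k :: nat
  assumes "k \<ge> 3"
  shows "(\<Sum>chi\<in>even_dirichlet_characters k. (norm (dirichlet_L 4 chi))\<^sup>2) =
    pi ^ 8 / (27 * real k ^ 8) * real (totient k) *
      (jordan_totient 8 k / 700 + jordan_totient 4 k / 150 + 2 / 21 * jordan_totient 2 k)"
proof -
  have k: "k \<ge> 2" using assms by simp
  define E where "E = (\<lambda>a::int. lattice_sum 4 (of_int a / real k))"
  have E: "E (int k - a) = E a" for a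
  proof -
    \<comment> \<open>The symmetry under \<open>a\<close> to \<open>k - a\<close> combines period 1
      with evenness of the lattice sum.\<close>
    have "of_int (int k - a) / real k = - (of_int a / real k) + of_int 1"
      using k by (simp add: diff_divide_distrib)
    then show ?thesis unfolding E_def by (simp only: lattice_sum_add_int lattice_sum_uminus even_numeral)
  qed
  have "(norm (dirichlet_L 4 chi))\<^sup>2 =
      1 / (4 * real k ^ 8) * (norm (\<Sum>a\<in>residue_units k. chi a * of_real (E a)))\<^sup>2"
    if "chi \<in> even_dirichlet_characters k" for chi
  proof -
    have "norm (\<Sum>a\<in>residue_units k. chi a * of_real (E a)) = 2 * real k ^ 4 * norm (dirichlet_L 4 chi)"
      unfolding E_def dirichlet_L_4_even[OF k that, symmetric] by (simp add: norm_mult norm_power)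
    then show ?thesis using k by (simp add: power_mult_distrib flip: power_mult)
  qed
  then have "(\<Sum>chi\<in>even_dirichlet_characters k. (norm (dirichlet_L 4 chi))\<^sup>2) =
      1 / (4 * real k ^ 8) * (real (totient k) * (\<Sum>a\<in>residue_units k. (E a)\<^sup>2))"
    by (simp only: sum_distrib_left[symmetric] sum_even_characters_parseval[where E = E, OF k E] cong: sum.cong)
  \<comment> \<open>The factor \<open>1/4\<close> turns the coefficients \<open>1/4725\<close>,
    \<open>2/2025\<close> and \<open>8/567\<close> into \<open>1/27\<close> times
    \<open>1/700\<close>, \<open>1/150\<close> and \<open>2/21\<close>.\<close>
  also have "\<dots> = pi ^ 8 / (27 * real k ^ 8) * real (totient k) *
      (jordan_totient 8 k / 700 + jordan_totient 4 k / 150 + 2 / 21 * jordan_totient 2 k)"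
    unfolding E_def sum_lattice_sum_4_squared_units[OF k] using k by (simp add: field_simps)
  finally show ?thesis .
qed

end
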